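(* Let $n\ge1$, $0\le q\le n-1$, and let $L[w]=w^{(n)}+\sum_{j=0}^{n-1}(a_j+b_jz)w^{(j)}$ with complex constants $a_j,b_j$ such that $a_0+b_0z\not\equiv0$, $b_j=0$ for $j>q$, and $b_q=(-1)^{n-q+1}$. Let $Q_0,Q_1,\phi_L$ be as in the context. Suppose that $t_0\ne0$ is a pole of $Q_0/Q_1$ of order $m$ with integer residue $\lambda_0=\operatorname{res}_{t_0}[Q_0/Q_1]$. Then the solution $$w(z)=\operatorname{res}_{t=t_0}\big[\phi_L(t)e^{-zt}\big]$$ of $L[w]=0$ has the form $w(z)=e^{-t_0z}W(z)$, where $W$ is a transcendental entire function of order of growth at most $1-\frac1m$ if $m>1$, and otherwise ($m=1$) $W$ is a polynomial of degree $\lambda_0$ if $\lambda_0\ge0$, or vanishes identically if $\lambda_0<0$.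
   Context: $Q_0(t)=(-t)^n+\sum_{j=0}^{n-1}a_j(-t)^j$, $Q_1(t)=\sum_{j=0}^{q}b_j(-t)^j$, and $$\phi_L(t)=\frac1{Q_1(t)}\exp\Big[-\int\frac{Q_0(t)}{Q_1(t)}\,dt\Big],$$ determined up to a non-zero constant factor. Since the residue of $Q_0/Q_1$ at $t_0$ is an integer, $\phi_L$ has a single-valued holomorphic branch in a punctured neighbourhood of $t_0$; such a branch is used in the residue. The order of growth of an entire function $f$ is $\limsup_{r\to\infty}\frac{\log\log M(r,f)}{\log r}$ with $M(r,f)=\max_{|z|=r}|f(z)|$.
   Formalization: For m=1 the claim on the degree or vanishing of W is proved only when Q_0(t_0)≠0, i.e. t_0 is not a common zero of Q_0 and Q_1; without this it is false, e.g. Q_1=(t-1)^2, Q_0=-t^2(t-1), t_0=1. In general W is still shown to be a polynomial. *)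

theory Defs
  imports "HOL-Complex_Analysis.Complex_Analysis"
begin

definition L_op :: "nat \<Rightarrow> (nat \<Rightarrow> complex) \<Rightarrow> (nat \<Rightarrow> complex) \<Rightarrow> (complex \<Rightarrow> complex) \<Rightarrow> complex \<Rightarrow> complex"
  where "L_op n a b w z = (deriv ^^ n) w z + (\<Sum>j<n. (a j + b j * z) * (deriv ^^ j) w z)"

definition Q0 :: "nat \<Rightarrow> (nat \<Rightarrow> complex) \<Rightarrow> complex \<Rightarrow> complex"
  where "Q0 n a t = (- t) ^ n + (\<Sum>j<n. a j * (- t) ^ j)"

definition Q1 :: "nat \<Rightarrow> (nat \<Rightarrow> complex) \<Rightarrow> complex \<Rightarrow> complex"
  where "Q1 q b t = (\<Sum>j\<le>q. b j * (- t) ^ j)"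

(* phi is a single-valued holomorphic branch of (1/Q1) exp(- integral of Q0/Q1) in a punctured
   neighbourhood of t0.  The primitive F is required only locally, because Q0/Q1 has in general
   only a multivalued primitive around t0.  The free constant factor of the branch is the
   integration constant of F.  Values of phi outside the punctured ball are unconstrained. *)
definition phi_branch ::
    "nat \<Rightarrow> nat \<Rightarrow> (nat \<Rightarrow> complex) \<Rightarrow> (nat \<Rightarrow> complex) \<Rightarrow> complex \<Rightarrow> (complex \<Rightarrow> complex) \<Rightarrow> bool"
  where "phi_branch n q a b t0 \<phi> \<longleftrightarrow>
    (\<exists>r>0. \<phi> holomorphic_on (ball t0 r - {t0}) \<and>
       (\<forall>t\<in>ball t0 r - {t0}. Q1 q b t \<noteq> 0) \<and>
       (\<forall>s\<in>ball t0 r - {t0}. \<exists>U F. open U \<and> s \<in> U \<and> U \<subseteq> ball t0 r - {t0} \<and>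
          (\<forall>t\<in>U. (F has_field_derivative Q0 n a t / Q1 q b t) (at t) \<and>
                 \<phi> t = 1 / Q1 q b t * exp (- F t))))"

definition max_modulus :: "real \<Rightarrow> (complex \<Rightarrow> complex) \<Rightarrow> real"
  where "max_modulus r f = (SUP z\<in>sphere 0 r. norm (f z))"

(* Meaningful for non-constant entire f, where max_modulus r f > 1 for all large r. *)
definition growth_order :: "(complex \<Rightarrow> complex) \<Rightarrow> ereal"
  where "growth_order f = Limsup at_top (\<lambda>r. ereal (ln (ln (max_modulus r f)) / ln r))"

definition transcendental_entire :: "(complex \<Rightarrow> complex) \<Rightarrow> bool"
  where "transcendental_entire f \<longleftrightarrow>
    f holomorphic_on UNIV \<and> \<not> (\<exists>p. \<forall>z. f z = poly p z)"

end

theory Submission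
  imports Defs
begin

text \<open>With \<open>s = t - t0\<close>, every branch has the form \<open>s\<^sup>N u(s) exp (- G(s) / s\<^sup>p)\<close>, where \<open>p = m - 1\<close>,
  \<open>N = - l0 - k\<close>, \<open>k\<close> is the order of \<open>Q1\<close> at \<open>t0\<close>, and \<open>u\<close>, \<open>G\<close> are holomorphic with \<open>u(0) \<noteq> 0\<close>.
  Since \<open>(Q1 \<phi>)' = - Q0 \<phi>\<close>, applying \<open>L\<close> under the residue produces the residue of an exact derivative.
  The factor \<open>W\<close> is the residue of \<open>\<phi> exp (- z s)\<close>: for \<open>m = 1\<close> the branch has at most a pole and \<open>W\<close> is a
  polynomial; for \<open>m > 1\<close> the circle \<open>|s| = |z| powr (- 1 / m)\<close> bounds the growth, and an equation
  \<open>W = poly\<close> would make the singularity of \<open>\<phi>\<close> inessential, contradicting the multiple pole of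
  \<open>Q0 / Q1 = - (Q1 \<phi>)' / (Q1 \<phi>)\<close>.\<close>

subsection \<open>Residues of exponential transforms\<close>

text \<open>The residue is the circle integral divided by \<open>2 * pi * \<i>\<close>, so the
  length \<open>2 * pi * \<rho>\<close> contributes only the factor \<open>\<rho>\<close>. The
  radius stays free, so that it can later be chosen depending on \<open>z\<close>.\<close>

lemma residue_circle_bound:
  assumes "g holomorphic_on ball t0 r - {t0}" "0 < \<rho>" "\<rho> < r"
    and "\<And>t. norm (t - t0) = \<rho> \<Longrightarrow> norm (g t) \<le> B"
  shows "norm (residue g t0) \<le> B * \<rho>"
proof -
  have "norm (t0 + of_real \<rho> - t0) = \<rho>"
    using assms(2) by simp
  then have B: "0 \<le> B"
    using assms(4) norm_ge_zero order_trans by blast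
  have "(g has_contour_integral 2 * pi * \<i> * residue g t0) (circlepath t0 \<rho>)"
    using assms by (intro base_residue[of "ball t0 r"]) auto
  then have "norm (2 * pi * \<i> * residue g t0) \<le> B * (2 * pi * \<rho>)"
    using has_contour_integral_bound_circlepath B assms by blast
  then show ?thesis
    by (simp add: norm_mult)
qed

text \<open>A function with a single-valued primitive integrates to zero over a closed circle. This
  yields both the differential equation for \<open>w\<close> and the value of the logarithmic
  coefficient of \<open>Q0 / Q1\<close>.\<close>

lemma residue_deriv_eq_0:
  assumes "0 < r"
    and F: "\<And>t. t \<in> ball t0 r - {t0} \<Longrightarrow> (F has_field_derivative f t) (at t)"
  shows "residue f t0 = 0"
proof -
  let ?A = "ball t0 r - {t0}"
  have "F holomorphic_on ?A"
    using F by (subst holomorphic_on_open) (blast intro: open_delete open_ball)+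
  then have "deriv F holomorphic_on ?A"
    by (intro holomorphic_deriv) (auto intro: open_delete)
  then have hol: "f holomorphic_on ?A"
    by (rule holomorphic_transform) (use F DERIV_imp_deriv in blast)
  have "(f has_contour_integral 2 * pi * \<i> * residue f t0) (circlepath t0 (r/2))"
    using assms(1) hol by (intro base_residue[of "ball t0 r"]) auto
  moreover have "(f has_contour_integral
      F (pathfinish (circlepath t0 (r/2))) - F (pathstart (circlepath t0 (r/2)))) (circlepath t0 (r/2))"
    using assms(1) F
    by (intro contour_integral_primitive[where S = ?A])
       (auto simp: dist_norm intro: has_field_derivative_at_within)
  ultimately show ?thesis
    using has_contour_integral_unique by fastforce
qed

text \<open>Differentiation under the integral sign on a fixed circle around \<open>t0\<close>. The
  shift \<open>c\<close> lets one statement serve both transforms: \<open>c = 0\<close> gives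
  \<open>w\<close>, and \<open>c = t0\<close> gives the factor \<open>W\<close>.\<close>

lemma has_field_derivative_residue_exp:
  assumes g: "g holomorphic_on ball t0 r - {t0}" and r: "0 < r"
  shows "((\<lambda>z. residue (\<lambda>t. g t * exp (- z * (t - c))) t0) has_field_derivative
          residue (\<lambda>t. - (t - c) * g t * exp (- z * (t - c))) t0) (at z)"
proof -
  define \<gamma> where "\<gamma> = circlepath t0 (r/2)"
  define d where "d = (\<lambda>x. vector_derivative \<gamma> (at x))"
  have im: "\<gamma> ` {0..1} \<subseteq> ball t0 r - {t0}"
    using r unfolding \<gamma>_def path_image_def[symmetric] by auto
  have \<gamma>: "continuous_on {0..1} \<gamma>"
    unfolding \<gamma>_def using path_def path_circlepath by blast
  have cd: "continuous_on {0..1} d"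
    unfolding d_def \<gamma>_def vector_derivative_circlepath by (intro continuous_intros)
  have g\<gamma>: "continuous_on {0..1} (\<lambda>x. g (\<gamma> x))"
    using continuous_on_compose2[OF holomorphic_on_imp_continuous_on[OF g] \<gamma> im] .
  have res: "residue h t0 = integral (cbox 0 1) (\<lambda>x. h (\<gamma> x) * d x) / (2 * pi * \<i>)"
    if "h holomorphic_on ball t0 r - {t0}" for h
  proof -
    have "(h has_contour_integral 2 * pi * \<i> * residue h t0) \<gamma>"
      unfolding \<gamma>_def using r that by (intro base_residue[of "ball t0 r"]) auto
    then have "contour_integral \<gamma> h = 2 * pi * \<i> * residue h t0"
      by (rule contour_integral_unique)
    then show ?thesis
      by (simp add: contour_integral_integral d_def)
  qed
  have eq1: "residue (\<lambda>t. g t * exp (- z * (t - c))) t0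
      = integral (cbox 0 1) (\<lambda>x. g (\<gamma> x) * exp (- z * (\<gamma> x - c)) * d x) / (2 * pi * \<i>)" for z
    by (rule res) (intro holomorphic_intros g)
  have eq2: "residue (\<lambda>t. - (t - c) * g t * exp (- z * (t - c))) t0
      = integral (cbox 0 1) (\<lambda>x. - (\<gamma> x - c) * g (\<gamma> x) * exp (- z * (\<gamma> x - c)) * d x) / (2 * pi * \<i>)"
    by (rule res) (intro holomorphic_intros g)
  \<comment> \<open>The Leibniz rule asks for joint continuity in \<open>(z, x)\<close>, but
    \<open>g\<close>, the path and its derivative depend on \<open>x\<close> alone.\<close>
  have snds: "continuous_on (UNIV \<times> {0..1}) (\<lambda>p::complex\<times>real. f (snd p))"
    if "continuous_on {0..1} f" for f :: "real \<Rightarrow> complex"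
    by (rule continuous_on_compose2[OF that]) (auto intro: continuous_intros)
  have "((\<lambda>z. integral (cbox 0 1) (\<lambda>x. g (\<gamma> x) * exp (- z * (\<gamma> x - c)) * d x)) has_field_derivative
      integral (cbox 0 1) (\<lambda>x. - (\<gamma> x - c) * g (\<gamma> x) * exp (- z * (\<gamma> x - c)) * d x)) (at z within UNIV)"
  proof (rule leibniz_rule_field_derivative)
    show "((\<lambda>z. g (\<gamma> x) * exp (- z * (\<gamma> x - c)) * d x) has_field_derivative
        - (\<gamma> x - c) * g (\<gamma> x) * exp (- z * (\<gamma> x - c)) * d x) (at z within UNIV)" for z x
      by (auto intro!: derivative_eq_intros simp: algebra_simps)
    show "(\<lambda>x. g (\<gamma> x) * exp (- z * (\<gamma> x - c)) * d x) integrable_on cbox 0 1" for z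
      by (intro integrable_continuous continuous_intros) (use g\<gamma> \<gamma> cd in auto)
    show "continuous_on (UNIV \<times> cbox 0 1)
        (\<lambda>(z, x). - (\<gamma> x - c) * g (\<gamma> x) * exp (- z * (\<gamma> x - c)) * d x)"
      unfolding case_prod_unfold cbox_interval
      by (intro continuous_intros snds g\<gamma> \<gamma> cd)
  qed auto
  then show ?thesis
    unfolding eq1 eq2 by (intro DERIV_cdivide) simp
qed

lemma higher_deriv_residue_exp:
  assumes g: "g holomorphic_on ball t0 r - {t0}" and r: "0 < r"
  shows "(deriv ^^ j) (\<lambda>z. residue (\<lambda>t. g t * exp (- z * (t - c))) t0)
       = (\<lambda>z. residue (\<lambda>t. (- (t - c)) ^ j * g t * exp (- z * (t - c))) t0)"
proof (induction j)
  case (Suc j)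
  have "((\<lambda>z. residue (\<lambda>t. ((- (t - c)) ^ j * g t) * exp (- z * (t - c))) t0) has_field_derivative
        residue (\<lambda>t. - (t - c) * ((- (t - c)) ^ j * g t) * exp (- z * (t - c))) t0) (at z)" for z
    by (intro has_field_derivative_residue_exp[OF _ r] holomorphic_intros g)
  from DERIV_imp_deriv[OF this] show ?case
    by (simp only: funpow.simps comp_apply Suc power_Suc mult.assoc)
qed simp

lemma holomorphic_residue_exp:
  assumes "g holomorphic_on ball t0 r - {t0}" and "0 < r"
  shows "(\<lambda>z. residue (\<lambda>t. g t * exp (- z * (t - c))) t0) holomorphic_on UNIV"
  using has_field_derivative_residue_exp[OF assms] by (subst holomorphic_on_open) auto

section \<open>Removing a singularity whose principal part vanishes\<close>

text \<open>Writing \<open>t - t0 = (t - z) + (z - t0)\<close> and using the vanishing moments gives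
  \<open>I (Suc N) = (z - t0) * I N\<close>. Thus \<open>I N\<close> grows exactly like the powers
  of \<open>z - t0\<close>, whereas a circle strictly inside radius \<open>dist t0 z\<close> bounds
  it by powers of a smaller number; hence \<open>I 0 = 0\<close>.\<close>

lemma residue_over_linear_eq_0:
  assumes g: "g holomorphic_on ball t0 r - {t0}" and r: "0 < r" and z: "z \<noteq> t0" "dist t0 z < r"
    and res: "\<And>j. residue (\<lambda>t. (t - t0) ^ j * g t) t0 = 0"
  shows "residue (\<lambda>t. g t / (t - z)) t0 = 0"
proof -
  define R where "R = dist t0 z"
  have R: "0 < R" "R < r" using z by (auto simp: R_def)
  have gR: "g holomorphic_on ball t0 R - {t0}"
    by (rule holomorphic_on_subset[OF g]) (use R in auto)
  have nz: "t - z \<noteq> 0" if "t \<in> ball t0 R - {t0}" for t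
    using that by (auto simp: R_def)
  define I where "I = (\<lambda>N::nat. residue (\<lambda>t. (t - t0) ^ N * g t / (t - z)) t0)"
  have hol: "(\<lambda>t. (t - t0) ^ N * g t / (t - z)) holomorphic_on ball t0 R - {t0}" for N
    by (intro holomorphic_intros gR nz)
  have Suc: "I (Suc N) = (z - t0) * I N" for N
  proof -
    have "I (Suc N) = residue (\<lambda>t. (t - t0) ^ N * g t + (z - t0) * ((t - t0) ^ N * g t / (t - z))) t0"
      unfolding I_def
    proof (rule residue_cong)
      have "\<forall>\<^sub>F t in at t0. t \<noteq> z"
        using z(1) by (intro tendsto_imp_eventually_ne[OF tendsto_ident_at]) auto
      then show "\<forall>\<^sub>F t in at t0. (t - t0) ^ Suc N * g t / (t - z)
          = (t - t0) ^ N * g t + (z - t0) * ((t - t0) ^ N * g t / (t - z))"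
        by eventually_elim (simp add: field_simps)
    qed simp
    also have "\<dots> = residue (\<lambda>t. (t - t0) ^ N * g t) t0 + residue (\<lambda>t. (z - t0) * ((t - t0) ^ N * g t / (t - z))) t0"
    proof (rule residue_add[of "ball t0 R"])
      show "(\<lambda>t. (t - t0) ^ N * g t) holomorphic_on ball t0 R - {t0}"
        by (intro holomorphic_intros gR)
      show "(\<lambda>t. (z - t0) * ((t - t0) ^ N * g t / (t - z))) holomorphic_on ball t0 R - {t0}"
        by (intro holomorphic_intros gR nz)
    qed (use R in auto)
    also have "\<dots> = (z - t0) * I N"
      unfolding I_def res using residue_lmul[OF _ _ hol] R by simp
    finally show ?thesis .
  qed
  have pow: "I N = (z - t0) ^ N * I 0" for N
    by (induction N) (auto simp: Suc)
  \<comment> \<open>Any radius strictly between \<open>0\<close> and \<open>R\<close> works: only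
    \<open>\<rho> / R < 1\<close> matters.\<close>
  define \<rho> where "\<rho> = R / 2"
  have \<rho>: "0 < \<rho>" "\<rho> < R" using R by (auto simp: \<rho>_def)
  have "compact ((\<lambda>t. g t / (t - z)) ` sphere t0 \<rho>)"
    by (intro compact_continuous_image holomorphic_on_imp_continuous_on
        holomorphic_on_subset[OF hol[of 0, simplified]]) (use \<rho> in auto)
  then obtain C where "\<forall>t\<in>sphere t0 \<rho>. norm (g t / (t - z)) \<le> C"
    by (auto dest!: compact_imp_bounded simp: bounded_iff)
  then have C: "norm (g t / (t - z)) \<le> C" if "norm (t - t0) = \<rho>" for t
    using that by (simp add: dist_norm norm_minus_commute)
  have le: "norm (I N) \<le> \<rho> ^ N * C * \<rho>" for N
    unfolding I_def
  proof (rule residue_circle_bound[OF hol \<rho>])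
    fix t assume t: "norm (t - t0) = \<rho>"
    have "norm ((t - t0) ^ N * g t / (t - z)) = \<rho> ^ N * norm (g t / (t - z))"
      by (simp add: norm_mult norm_power norm_divide t)
    then show "norm ((t - t0) ^ N * g t / (t - z)) \<le> \<rho> ^ N * C"
      using C[OF t] \<rho> by (simp add: mult_left_mono)
  qed
  have "norm (I 0) \<le> (\<rho> / R) ^ N * (C * \<rho>)" for N
  proof -
    have "norm (I N) = R ^ N * norm (I 0)"
      by (subst pow) (simp add: norm_mult norm_power R_def dist_norm norm_minus_commute)
    with le[of N] have "R ^ N * norm (I 0) \<le> \<rho> ^ N * C * \<rho>"
      by (simp only:)
    then show ?thesis
      using R by (simp add: power_divide pos_le_divide_eq mult_ac)
  qed
  moreover have "(\<lambda>N. (\<rho> / R) ^ N * (C * \<rho>)) \<longlonglongrightarrow> 0 * (C * \<rho>)"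
    by (intro tendsto_mult tendsto_const LIMSEQ_realpow_zero) (use \<rho> R in auto)
  ultimately have "norm (I 0) \<le> 0"
    by (intro LIMSEQ_le_const[of "\<lambda>N. (\<rho> / R) ^ N * (C * \<rho>)"]) auto
  then show ?thesis
    by (simp add: I_def)
qed

text \<open>The principal part of the Laurent expansion vanishes, so only the outer circle contributes
  to the Cauchy formula in an annulus.\<close>

lemma holomorphic_extension_if_residues_0:
  assumes g: "g holomorphic_on ball t0 r - {t0}" and r: "0 < R" "R < r"
    and res: "\<And>j. residue (\<lambda>t. (t - t0) ^ j * g t) t0 = 0"
  obtains h where "h holomorphic_on ball t0 R" "\<And>z. z \<in> ball t0 R - {t0} \<Longrightarrow> h z = g z"
proof -
  define H where "H = (\<lambda>z. contour_integral (circlepath t0 R) (\<lambda>t. g t / (t - z)))"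
  have contg: "continuous_on (sphere t0 R) g"
    by (intro holomorphic_on_imp_continuous_on holomorphic_on_subset[OF g]) (use r in auto)
  have int: "(\<lambda>t. g t / (t - z)) contour_integrable_on circlepath t0 R" if "z \<in> ball t0 R" for z
    using that r by (intro contour_integrable_continuous_circlepath continuous_intros)
      (use contg in auto)
  have H: "H holomorphic_on ball t0 R"
  proof (subst holomorphic_on_open, simp, safe)
    fix w assume w: "w \<in> ball t0 R"
    show "\<exists>f'. (H has_field_derivative f') (at w)"
      using Cauchy_next_derivative_circlepath(2)[of t0 R g 1 H w] contg int w r
      by (auto simp: H_def intro: has_contour_integral_integral)
  qed
  have eq: "H z = 2 * pi * \<i> * g z" if z: "z \<in> ball t0 R - {t0}" for z
  proof -
    \<comment> \<open>The difference quotient is holomorphic at \<open>z\<close>, so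
      \<open>t0\<close> is the only singularity of \<open>k\<close> inside the circle. Its residue
      there is zero, and the remaining term \<open>g z / (t - z)\<close> is evaluated by the Cauchy
      formula.\<close>
    define k where "k = (\<lambda>t. if t = z then deriv g z else (g t - g z) / (t - z))"
    have zr: "dist t0 z < r" using z r by auto
    have k: "k holomorphic_on ball t0 r - {t0}"
      unfolding k_def by (rule pole_lemma_open[OF g]) (auto intro: open_delete)
    have hasR: "(k has_contour_integral 2 * pi * \<i> * residue k t0) (circlepath t0 R)"
      using k r by (intro base_residue[of "ball t0 r"]) auto
    have "residue k t0 = residue (\<lambda>t. g t / (t - z) - g z / (t - z)) t0"
    proof (rule residue_cong)
      have "\<forall>\<^sub>F t in at t0. t \<noteq> z"
        using z by (intro tendsto_imp_eventually_ne[OF tendsto_ident_at]) auto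
      then show "\<forall>\<^sub>F t in at t0. k t = g t / (t - z) - g z / (t - z)"
        by eventually_elim (simp add: k_def diff_divide_distrib)
    qed simp
    also have "\<dots> = residue (\<lambda>t. g t / (t - z)) t0 - residue (\<lambda>t. g z / (t - z)) t0"
      by (rule residue_diff[of "ball t0 (dist t0 z)"])
         (use z zr in \<open>auto intro!: holomorphic_intros holomorphic_on_subset[OF g]\<close>)
    also have "residue (\<lambda>t. g z / (t - z)) t0 = 0"
      by (rule residue_holo[of "ball t0 (dist t0 z)"]) (use z in \<open>auto intro!: holomorphic_intros\<close>)
    also have "residue (\<lambda>t. g t / (t - z)) t0 = 0"
      using z zr r by (intro residue_over_linear_eq_0[OF g _ _ _ res]) auto
    finally have "(k has_contour_integral 0) (circlepath t0 R)"
      using hasR by simp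
    moreover have "((\<lambda>t. g z / (t - z)) has_contour_integral 2 * pi * \<i> * g z) (circlepath t0 R)"
      using Cauchy_integral_circlepath_simple[of "\<lambda>_. g z" t0 R z] z
      by (auto simp: norm_minus_commute dist_norm)
    ultimately have "((\<lambda>t. k t + g z / (t - z)) has_contour_integral 0 + 2 * pi * \<i> * g z) (circlepath t0 R)"
      by (rule has_contour_integral_add)
    then have "((\<lambda>t. g t / (t - z)) has_contour_integral 0 + 2 * pi * \<i> * g z) (circlepath t0 R)"
      by (rule has_contour_integral_eq) (use z r in \<open>auto simp: k_def diff_divide_distrib\<close>)
    then show ?thesis
      unfolding H_def by (auto dest: contour_integral_unique)
  qed
  show thesis
  proof
    show "(\<lambda>z. H z / (2 * pi * \<i>)) holomorphic_on ball t0 R"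
      by (intro holomorphic_intros H) auto
    show "H z / (2 * pi * \<i>) = g z" if "z \<in> ball t0 R - {t0}" for z
      using eq[OF that] by simp
  qed
qed

section \<open>Polynomials among entire functions\<close>

lemma entire_polynomial_if_higher_deriv_0:
  assumes f: "f holomorphic_on UNIV" and 0: "\<And>j. j > N \<Longrightarrow> (deriv ^^ j) f 0 = 0"
  shows "f z = poly (\<Sum>i\<le>N. monom ((deriv ^^ i) f 0 / fact i) i) z"
proof -
  have "(\<lambda>i. (deriv ^^ i) f 0 / fact i * (z - 0) ^ i) sums f z"
    by (rule holomorphic_power_series[of _ _ "norm z + 1"])
       (use f in \<open>auto intro: holomorphic_on_subset\<close>)
  moreover have "(\<lambda>i. (deriv ^^ i) f 0 / fact i * (z - 0) ^ i) sums
      (\<Sum>i\<le>N. (deriv ^^ i) f 0 / fact i * (z - 0) ^ i)"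
    by (rule sums_finite) (use 0 in auto)
  ultimately show ?thesis
    by (auto simp: poly_sum poly_monom dest: sums_unique2)
qed

lemma higher_deriv_poly: "(deriv ^^ j) (poly p) = poly ((pderiv ^^ j) (p :: complex poly))"
proof (induction j)
  case (Suc j)
  show ?case
    by (simp add: Suc fun_eq_iff DERIV_imp_deriv[OF poly_DERIV])
qed simp

lemma higher_deriv_poly_eq_0:
  assumes "degree (p :: complex poly) < j"
  shows "(deriv ^^ j) (poly p) = (\<lambda>_. 0)"
proof -
  have "(pderiv ^^ j) p = 0"
    using assms by (intro poly_eqI) (simp add: coeff_higher_pderiv coeff_eq_0)
  then show ?thesis
    by (auto simp: higher_deriv_poly)
qed

subsection \<open>Order of growth\<close>

lemma norm_le_max_modulus:
  assumes "f holomorphic_on UNIV" "norm z = r"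
  shows "norm (f z) \<le> max_modulus r f"
proof -
  have "compact ((\<lambda>z. norm (f z)) ` sphere 0 r)"
    by (intro compact_continuous_image continuous_intros holomorphic_on_imp_continuous_on
        holomorphic_on_subset[OF assms(1)]) auto
  then have "bdd_above ((\<lambda>z. norm (f z)) ` sphere 0 r)"
    by (intro bounded_imp_bdd_above compact_imp_bounded)
  then show ?thesis
    unfolding max_modulus_def using assms(2) by (intro cSUP_upper) auto
qed

lemma max_modulus_le:
  assumes "0 \<le> r" "\<And>z. norm z = r \<Longrightarrow> norm (f z) \<le> B"
  shows "max_modulus r f \<le> B"
  unfolding max_modulus_def using assms by (intro cSUP_least) auto

text \<open>Some Taylor coefficient of positive index \<open>j\<close> is non-zero, and the Cauchy
  inequality for it forces growth at least like \<open>r ^ j\<close>. With \<open>c = 1\<close> this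
  makes the iterated logarithm in \<open>growth_order\<close> meaningful for large
  \<open>r\<close>.\<close>

lemma eventually_max_modulus_gt:
  assumes f: "transcendental_entire f"
  shows "\<forall>\<^sub>F r in at_top. c < max_modulus r f"
proof -
  have hol: "f holomorphic_on UNIV"
    using f by (simp add: transcendental_entire_def)
  have "\<not> (\<forall>j>0. (deriv ^^ j) f 0 = 0)"
    using f entire_polynomial_if_higher_deriv_0[OF hol, of 0] unfolding transcendental_entire_def by blast
  then obtain j where j: "j > 0" "(deriv ^^ j) f 0 \<noteq> 0"
    by auto
  define d where "d = norm ((deriv ^^ j) f 0) / fact j"
  have d: "d > 0" using j by (simp add: d_def)
  have "filterlim (\<lambda>r. d * r ^ j) at_top at_top"
    by (intro filterlim_tendsto_pos_mult_at_top[OF tendsto_const d] filterlim_pow_at_top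
        filterlim_ident j)
  then have "\<forall>\<^sub>F r in at_top. c < d * r ^ j"
    by (simp add: filterlim_at_top_dense)
  with eventually_gt_at_top[of 0] show ?thesis
  proof eventually_elim
    case (elim r)
    have "norm ((deriv ^^ j) f 0) \<le> fact j * max_modulus r f / r ^ j"
      using norm_le_max_modulus[OF hol] elim
      by (intro Cauchy_inequality holomorphic_on_imp_continuous_on holomorphic_on_subset[OF hol]) auto
    then have "d * r ^ j \<le> max_modulus r f"
      using elim by (simp add: d_def field_simps)
    with elim show ?case by simp
  qed
qed

text \<open>Taking logarithms twice turns the bound into \<open>ln B + \<alpha> * ln r\<close>;
  after division by \<open>ln r\<close> the constant \<open>B\<close> disappears in the
  limit.\<close>

lemma growth_order_le:
  assumes f: "transcendental_entire f" and B: "0 < B"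
    and bound: "\<forall>\<^sub>F r in at_top. \<forall>z. norm z = r \<longrightarrow> norm (f z) \<le> exp (B * r powr \<alpha>)"
  shows "growth_order f \<le> ereal \<alpha>"
proof -
  have "((\<lambda>r::real. ln B / ln r + \<alpha>) \<longlongrightarrow> 0 + \<alpha>) at_top"
    by (intro tendsto_add tendsto_const real_tendsto_divide_at_top[OF tendsto_const] ln_at_top)
  then have lim: "((\<lambda>r. ereal (ln B / ln r + \<alpha>)) \<longlongrightarrow> ereal \<alpha>) at_top"
    by simp
  have "\<forall>\<^sub>F r in at_top. ereal (ln (ln (max_modulus r f)) / ln r) \<le> ereal (ln B / ln r + \<alpha>)"
    using bound eventually_max_modulus_gt[OF f, of 1] eventually_gt_at_top[of 1]
  proof eventually_elim
    case (elim r)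
    have "max_modulus r f \<le> exp (B * r powr \<alpha>)"
      using elim by (intro max_modulus_le) auto
    then have "ln (max_modulus r f) \<le> ln (exp (B * r powr \<alpha>))"
      using elim by (intro ln_mono) auto
    then have "ln (max_modulus r f) \<le> B * r powr \<alpha>"
      by simp
    moreover have "0 < ln (max_modulus r f)"
      using elim by simp
    ultimately have "ln (ln (max_modulus r f)) \<le> ln (B * r powr \<alpha>)"
      by (intro ln_mono) auto
    also have "\<dots> = ln B + \<alpha> * ln r"
      using B elim by (simp add: ln_mult ln_powr)
    finally show ?case
      using elim by (simp add: field_simps)
  qed
  then have "growth_order f \<le> Limsup at_top (\<lambda>r. ereal (ln B / ln r + \<alpha>))"
    unfolding growth_order_def by (rule Limsup_mono)
  also have "\<dots> = ereal \<alpha>"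
    by (rule lim_imp_Limsup[OF _ lim]) simp
  finally show ?thesis .
qed

text \<open>The radius \<open>\<rho> = |z|\<close> powr \<open>(- 1 / (p + 1))\<close> balances \<open>exp (K / \<rho>\<^sup>p)\<close> against
  \<open>exp (|z| \<rho>)\<close>.\<close>

lemma residue_exp_growth:
  assumes g: "g holomorphic_on ball t0 r - {t0}" and r: "0 < r"
    and K: "\<And>t. t \<in> ball t0 r - {t0} \<Longrightarrow> norm (g t) \<le> C * exp (K / norm (t - t0) ^ p)"
  shows "\<forall>\<^sub>F x in at_top. \<forall>z. norm z = x \<longrightarrow>
      norm (residue (\<lambda>t. g t * exp (- z * (t - t0))) t0) \<le> exp ((K + 1) * x powr (1 - 1 / real (Suc p)))"
proof -
  define \<rho> where "\<rho> = (\<lambda>x::real. x powr (- (1 / real (Suc p))))"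
  have lim: "(\<rho> \<longlongrightarrow> 0) at_top"
    unfolding \<rho>_def by (rule tendsto_neg_powr[OF _ filterlim_ident]) simp
  then have "((\<lambda>x. C * \<rho> x) \<longlongrightarrow> C * 0) at_top"
    by (intro tendsto_mult tendsto_const)
  \<comment> \<open>For large \<open>x\<close> the shrinking radius absorbs the constant
    \<open>C\<close>, so no constant remains in front of the exponential.\<close>
  then have "\<forall>\<^sub>F x in at_top. C * \<rho> x < 1"
    by (simp add: order_tendsto_iff)
  moreover have "\<forall>\<^sub>F x in at_top. \<rho> x < r"
    using lim r by (simp add: order_tendsto_iff)
  ultimately show ?thesis
    using eventually_gt_at_top[of 0]
  proof eventually_elim
    case (elim x)
    have \<rho>0: "0 < \<rho> x" using elim by (simp add: \<rho>_def)
    have 1: "x * \<rho> x = x powr (1 - 1 / real (Suc p))"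
      using elim powr_add[of x 1 "- (1 / real (Suc p))"] by (simp add: \<rho>_def)
    have "\<rho> x ^ p = x powr (- (1 / real (Suc p)) * real p)"
      unfolding \<rho>_def using elim by (simp add: powr_power)
    moreover have "- (1 / real (Suc p)) * real p = - (1 - 1 / real (Suc p))"
      by (simp add: field_simps)
    ultimately have "\<rho> x ^ p = x powr (- (1 - 1 / real (Suc p)))"
      by (simp only:)
    then have 2: "1 / \<rho> x ^ p = x powr (1 - 1 / real (Suc p))"
      by (simp add: powr_minus field_simps)
    have "norm (residue (\<lambda>t. g t * exp (- z * (t - t0))) t0) \<le> exp ((K + 1) * x powr (1 - 1 / real (Suc p)))"
      if z: "norm z = x" for z
    proof -
      have "norm (residue (\<lambda>t. g t * exp (- z * (t - t0))) t0)
          \<le> (C * exp (K / \<rho> x ^ p) * exp (x * \<rho> x)) * \<rho> x"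
      proof (rule residue_circle_bound[where r = r])
        show "(\<lambda>t. g t * exp (- z * (t - t0))) holomorphic_on ball t0 r - {t0}"
          by (intro holomorphic_intros g)
        fix t assume t: "norm (t - t0) = \<rho> x"
        have "norm (exp (- z * (t - t0))) \<le> exp (norm (- z * (t - t0)))"
          by (rule norm_exp)
        also have "norm (- z * (t - t0)) = x * \<rho> x"
          using t z by (simp add: norm_mult)
        finally have "norm (exp (- z * (t - t0))) \<le> exp (x * \<rho> x)" .
        moreover have "norm (g t) \<le> C * exp (K / \<rho> x ^ p)"
          using K[of t] t elim \<rho>0 by (cases "t = t0") (auto simp: dist_norm norm_minus_commute)
        ultimately show "norm (g t * exp (- z * (t - t0))) \<le> C * exp (K / \<rho> x ^ p) * exp (x * \<rho> x)"
          unfolding norm_mult by (intro mult_mono') auto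
      qed (use elim \<rho>0 in auto)
      also have "\<dots> = (C * \<rho> x) * exp ((K + 1) * x powr (1 - 1 / real (Suc p)))"
        using 1 2 by (simp add: exp_add[symmetric] distrib_right divide_inverse)
      also have "\<dots> \<le> 1 * exp ((K + 1) * x powr (1 - 1 / real (Suc p)))"
        using elim by (intro mult_right_mono) auto
      finally show ?thesis by simp
    qed
    then show ?case by blast
  qed
qed

subsection \<open>Branches\<close>

text \<open>Term-by-term integration of a Laurent series without using the series: each step splits
  off \<open>g t0\<close> and passes to the difference quotient. The constant \<open>c\<close> is
  the residue, the one term without a single-valued primitive.\<close>

lemma punctured_primitive:
  assumes "g holomorphic_on ball t0 r"
  shows "\<exists>G c. G holomorphic_on ball t0 r \<and> (\<forall>t\<in>ball t0 r - {t0}.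
      ((\<lambda>t. G t / (t - t0) ^ p) has_field_derivative g t / (t - t0) ^ Suc p - c / (t - t0)) (at t))"
  using assms
proof (induction p arbitrary: g)
  case (0 g)
  define g1 where "g1 = (\<lambda>z. if z = t0 then deriv g t0 else (g z - g t0) / (z - t0))"
  have g1: "g1 holomorphic_on ball t0 r"
    unfolding g1_def by (rule pole_lemma_open[OF 0]) simp
  have "\<exists>G. \<forall>t\<in>ball t0 r. (G has_field_derivative g1 t) (at t within ball t0 r)"
    by (rule holomorphic_convex_primitive'[OF convex_ball open_ball g1], rule exI, rule ballI)
  then obtain G where G: "\<And>t. t \<in> ball t0 r \<Longrightarrow> (G has_field_derivative g1 t) (at t within ball t0 r)"
    by blast
  have dG: "(G has_field_derivative g1 t) (at t)" if "t \<in> ball t0 r" for t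
    using G[OF that] unfolding at_within_open[OF that open_ball] .
  then have "G holomorphic_on ball t0 r"
    by (subst holomorphic_on_open) blast+
  moreover have "(G has_field_derivative g t / (t - t0) - g t0 / (t - t0)) (at t)"
    if "t \<in> ball t0 r - {t0}" for t
    using dG[of t] that by (simp add: g1_def diff_divide_distrib)
  ultimately show ?case
    by (intro exI[of _ G] exI[of _ "g t0"]) simp
next
  case (Suc p g)
  define g1 where "g1 = (\<lambda>z. if z = t0 then deriv g t0 else (g z - g t0) / (z - t0))"
  have "g1 holomorphic_on ball t0 r"
    unfolding g1_def by (rule pole_lemma_open[OF Suc.prems]) simp
  from Suc.IH[OF this] obtain G c where G: "G holomorphic_on ball t0 r"
    and dG: "\<And>t. t \<in> ball t0 r - {t0} \<Longrightarrow>
      ((\<lambda>t. G t / (t - t0) ^ p) has_field_derivative g1 t / (t - t0) ^ Suc p - c / (t - t0)) (at t)"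
    by blast
  \<comment> \<open>The constant subtracted here contributes
    \<open>- g t0 / of_nat (Suc p) / (t - t0) ^ Suc p\<close>, a primitive of the leading term
    \<open>g t0 / (t - t0) ^ Suc (Suc p)\<close>.\<close>
  define H where "H = (\<lambda>t. (t - t0) * G t - g t0 / of_nat (Suc p))"
  have "((\<lambda>t. H t / (t - t0) ^ Suc p) has_field_derivative g t / (t - t0) ^ Suc (Suc p) - c / (t - t0)) (at t)"
    if t: "t \<in> ball t0 r - {t0}" for t
  proof -
    have "((\<lambda>t. 1 / (t - t0) ^ Suc p) has_field_derivative - of_nat (Suc p) / (t - t0) ^ Suc (Suc p)) (at t)"
    proof -
      have "((\<lambda>t. (t - t0) ^ Suc p) has_field_derivative of_nat (Suc p) * (t - t0) ^ p) (at t)"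
        by (auto intro!: derivative_eq_intros simp del: power_Suc of_nat_Suc)
      from DERIV_inverse'[OF this] show ?thesis
        using t by (simp add: divide_inverse mult_ac del: of_nat_Suc)
    qed
    from DERIV_diff[OF dG[OF t] DERIV_cmult[OF this, of "g t0 / of_nat (Suc p)"]]
    have "((\<lambda>t. G t / (t - t0) ^ p - g t0 / of_nat (Suc p) * (1 / (t - t0) ^ Suc p)) has_field_derivative
        g1 t / (t - t0) ^ Suc p - c / (t - t0) + g t0 / (t - t0) ^ Suc (Suc p)) (at t)"
      by (simp del: of_nat_Suc)
    also have "g1 t / (t - t0) ^ Suc p - c / (t - t0) + g t0 / (t - t0) ^ Suc (Suc p)
        = g t / (t - t0) ^ Suc (Suc p) - c / (t - t0)"
      using t by (simp add: g1_def divide_simps)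
    finally show ?thesis
    proof (rule has_field_derivative_transform_within_open)
      show "open (ball t0 r - {t0})" by (intro open_delete) simp
      show "G x / (x - t0) ^ p - g t0 / of_nat (Suc p) * (1 / (x - t0) ^ Suc p) = H x / (x - t0) ^ Suc p"
        if "x \<in> ball t0 r - {t0}" for x
        using that by (simp add: H_def diff_divide_distrib del: of_nat_Suc)
    qed (use t in auto)
  qed
  moreover have "H holomorphic_on ball t0 r"
    unfolding H_def by (intro holomorphic_intros G) (simp del: of_nat_Suc)
  ultimately show ?case by blast
qed

text \<open>The local primitives \<open>F\<close> are eliminated here: \<open>Q1 \<phi>\<close> is
  locally \<open>exp (- F)\<close>, and its derivative no longer mentions \<open>F\<close>, so one
  equation holds on the whole punctured ball. Later arguments about arbitrary branches rest on
  it.\<close>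

lemma phi_branch_deriv:
  assumes "phi_branch n q a b t0 \<phi>"
  obtains r where "0 < r" "\<phi> holomorphic_on ball t0 r - {t0}"
    "\<forall>t\<in>ball t0 r - {t0}. Q1 q b t \<noteq> 0 \<and> \<phi> t \<noteq> 0 \<and>
      ((\<lambda>t. Q1 q b t * \<phi> t) has_field_derivative - (Q0 n a t * \<phi> t)) (at t)"
proof -
  from assms obtain r where r: "0 < r" "\<phi> holomorphic_on ball t0 r - {t0}"
    and Q: "\<And>t. t \<in> ball t0 r - {t0} \<Longrightarrow> Q1 q b t \<noteq> 0"
    and F: "\<And>s. s \<in> ball t0 r - {t0} \<Longrightarrow> \<exists>U F. open U \<and> s \<in> U \<and> U \<subseteq> ball t0 r - {t0} \<and>
          (\<forall>t\<in>U. (F has_field_derivative Q0 n a t / Q1 q b t) (at t) \<and>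
                 \<phi> t = 1 / Q1 q b t * exp (- F t))"
    unfolding phi_branch_def by blast
  show thesis
  proof (rule that[OF r], intro ballI conjI)
    fix t assume t: "t \<in> ball t0 r - {t0}"
    from F[OF t] obtain U F where U: "open U" "t \<in> U" "U \<subseteq> ball t0 r - {t0}"
      and dF: "\<And>t. t \<in> U \<Longrightarrow> (F has_field_derivative Q0 n a t / Q1 q b t) (at t)"
      and \<phi>: "\<And>t. t \<in> U \<Longrightarrow> \<phi> t = 1 / Q1 q b t * exp (- F t)"
      by blast
    show "Q1 q b t \<noteq> 0"
      using Q[OF t] .
    have QU: "Q1 q b t \<noteq> 0" if "t \<in> U" for t
      using that Q U(3) by blast
    show "\<phi> t \<noteq> 0"
      using \<phi>[OF U(2)] Q[OF t] by simp
    have "((\<lambda>t. exp (- F t)) has_field_derivative - (Q0 n a t * \<phi> t)) (at t)"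
      using \<phi>[OF U(2)] by (auto intro!: derivative_eq_intros dF U)
    then show "((\<lambda>t. Q1 q b t * \<phi> t) has_field_derivative - (Q0 n a t * \<phi> t)) (at t)"
      by (rule has_field_derivative_transform_within_open[OF _ U(1,2)]) (simp add: \<phi> QU)
  qed
qed

text \<open>\<open>Q1 \<phi>\<close> and \<open>Q1 \<psi>\<close> solve the same first-order linear
  equation, so their quotient has derivative zero, and a punctured disc is connected.\<close>

lemma phi_branch_unique:
  assumes "phi_branch n q a b t0 \<phi>" "phi_branch n q a b t0 \<psi>"
  obtains r c where "0 < r" "c \<noteq> 0" "\<And>t. t \<in> ball t0 r - {t0} \<Longrightarrow> \<phi> t = c * \<psi> t"
proof -
  obtain r1 where r1: "0 < r1"
    "\<forall>t\<in>ball t0 r1 - {t0}. Q1 q b t \<noteq> 0 \<and> \<phi> t \<noteq> 0 \<and>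
      ((\<lambda>t. Q1 q b t * \<phi> t) has_field_derivative - (Q0 n a t * \<phi> t)) (at t)"
    using phi_branch_deriv[OF assms(1)] by blast
  obtain r2 where r2: "0 < r2"
    "\<forall>t\<in>ball t0 r2 - {t0}. Q1 q b t \<noteq> 0 \<and> \<psi> t \<noteq> 0 \<and>
      ((\<lambda>t. Q1 q b t * \<psi> t) has_field_derivative - (Q0 n a t * \<psi> t)) (at t)"
    using phi_branch_deriv[OF assms(2)] by blast
  define r where "r = min r1 r2"
  define A where "A = ball t0 r - {t0}"
  have A: "t \<in> ball t0 r1 - {t0}" "t \<in> ball t0 r2 - {t0}" if "t \<in> A" for t
    using that by (auto simp: A_def r_def)
  define f where "f = (\<lambda>t. (Q1 q b t * \<phi> t) / (Q1 q b t * \<psi> t))"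
  have df: "(f has_field_derivative 0) (at t)" if "t \<in> A" for t
  proof -
    note t = bspec[OF r1(2) A(1)[OF that]] bspec[OF r2(2) A(2)[OF that]]
    have "(f has_field_derivative (- (Q0 n a t * \<phi> t) * (Q1 q b t * \<psi> t)
        - Q1 q b t * \<phi> t * - (Q0 n a t * \<psi> t)) / (Q1 q b t * \<psi> t * (Q1 q b t * \<psi> t))) (at t)"
      unfolding f_def by (intro DERIV_divide) (use t in auto)
    then show ?thesis
      by (simp add: mult_ac)
  qed
  have oA: "open A"
    unfolding A_def by (intro open_delete) simp
  have "f constant_on A"
  proof (rule DERIV_zero_connected_constant_on[of _ "{}"])
    show "connected A"
      unfolding A_def by (intro connected_punctured_ball) simp
    show "continuous_on A f"
      using df by (meson DERIV_continuous_on has_field_derivative_at_within)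
  qed (use df oA in auto)
  then obtain c where c: "\<And>t. t \<in> A \<Longrightarrow> f t = c"
    unfolding constant_on_def by blast
  have eq: "\<phi> t = c * \<psi> t" if "t \<in> A" for t
    using c[OF that] bspec[OF r1(2) A(1)[OF that]] bspec[OF r2(2) A(2)[OF that]] by (auto simp: f_def)
  have r0: "r > 0" using r1 r2 by (simp add: r_def)
  then have t1: "t0 + of_real (r / 2) \<in> A"
    by (auto simp: A_def dist_norm)
  have "c \<noteq> 0"
    using eq[OF t1] bspec[OF r1(2) A(1)[OF t1]] by auto
  then show thesis
    using that r0 eq unfolding A_def by blast
qed

lemma holomorphic_Q0 [holomorphic_intros]: "Q0 n a holomorphic_on S"
  unfolding Q0_def by (intro holomorphic_intros)

lemma holomorphic_Q1 [holomorphic_intros]: "Q1 q b holomorphic_on S"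
  unfolding Q1_def by (intro holomorphic_intros)

text \<open>The primitive of \<open>Q0 / Q1\<close> is a meromorphic part
  \<open>G t / (t - t0) ^ (m - 1)\<close> plus \<open>l0\<close> times a logarithm. Since
  \<open>l0\<close> is an integer, exponentiation turns the logarithm into the single-valued power
  \<open>(t - t0) powi (- l0)\<close>; the factor \<open>1 / Q1\<close> contributes \<open>u\<close>
  and the exponent \<open>- int k\<close>.\<close>

lemma phi_branch_exists:
  assumes pole: "is_pole (\<lambda>t. Q0 n a t / Q1 q b t) t0"
    and pole_order: "zorder (\<lambda>t. Q0 n a t / Q1 q b t) t0 = - int m"
    and res: "residue (\<lambda>t. Q0 n a t / Q1 q b t) t0 = of_int l0"
  obtains r k u G \<phi> where "0 < r" "u holomorphic_on ball t0 r" "G holomorphic_on ball t0 r"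
    "\<And>t. t \<in> ball t0 r \<Longrightarrow> u t \<noteq> 0"
    "\<And>t. \<phi> t = (t - t0) powi (- l0 - int k) * u t * exp (- G t / (t - t0) ^ (m - 1))"
    "phi_branch n q a b t0 \<phi>" "Q0 n a t0 \<noteq> 0 \<Longrightarrow> k = m"
proof -
  let ?f = "\<lambda>t. Q0 n a t / Q1 q b t"
  have "\<forall>\<^sub>F t in at t0. ?f t \<noteq> 0"
    by (rule non_zero_neighbour_pole[OF pole])
  then have "\<forall>\<^sub>F t in at t0. Q1 q b t \<noteq> 0"
    by eventually_elim auto
  then have ex: "\<exists>w\<in>UNIV. Q1 q b w \<noteq> 0"
    using eventually_happens'[of "at t0"] by auto
  define v where "v = zor_poly (Q1 q b) t0"
  define k where "k = nat (zorder (Q1 q b) t0)"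
  obtain r1 where r1: "0 < r1" and v: "v holomorphic_on cball t0 r1"
    and Q1v: "\<forall>t\<in>cball t0 r1. Q1 q b t = v t * (t - t0) ^ k \<and> v t \<noteq> 0"
    using zorder_exist_zero[OF holomorphic_Q1 open_UNIV connected_UNIV UNIV_I ex]
    unfolding v_def k_def by blast
  have Q1: "Q1 q b t = v t * (t - t0) ^ k" and v0: "v t \<noteq> 0" if "t \<in> cball t0 r1" for t
    using Q1v that by auto
  have hol: "?f holomorphic_on ball t0 r1 - {t0}"
    by (intro holomorphic_intros) (use Q1 v0 in auto)
  \<comment> \<open>A pole has positive order, so truncated subtraction in \<open>m - 1\<close>
    loses nothing.\<close>
  have m: "m = Suc (m - 1)"
    using zorder_exist_pole[OF hol _ _ pole] r1 pole_order by simp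
  obtain g r where r: "0 < r" "cball t0 r \<subseteq> ball t0 r1" and g: "g holomorphic_on cball t0 r"
    and f: "\<And>t. t \<in> cball t0 r - {t0} \<Longrightarrow> ?f t = g t / (t - t0) ^ m"
    using zorder_exist_pole[OF hol _ _ pole] r1 pole_order by auto
  have inc: "t \<in> cball t0 r1" if "t \<in> ball t0 r" for t
    using that r(2) ball_subset_cball by blast
  have g': "g holomorphic_on ball t0 r"
    by (rule holomorphic_on_subset[OF g]) auto
  from punctured_primitive[OF g', of "m - 1", folded m] obtain G c where G: "G holomorphic_on ball t0 r"
    and dG: "\<And>t. t \<in> ball t0 r - {t0} \<Longrightarrow>
      ((\<lambda>t. G t / (t - t0) ^ (m - 1)) has_field_derivative g t / (t - t0) ^ m - c / (t - t0)) (at t)"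
    by blast
  have dG': "((\<lambda>t. G t / (t - t0) ^ (m - 1)) has_field_derivative ?f t - c / (t - t0)) (at t)"
    if "t \<in> ball t0 r - {t0}" for t
    using dG[OF that] f[of t] that by auto
  have holr: "?f holomorphic_on ball t0 r - {t0}"
    by (rule holomorphic_on_subset[OF hol]) (use r in auto)
  \<comment> \<open>An exact derivative has residue zero, which identifies \<open>c\<close> with the
    given residue \<open>l0\<close>.\<close>
  have "0 = residue (\<lambda>t. ?f t - c / (t - t0)) t0"
    by (rule residue_deriv_eq_0[OF r(1) dG', symmetric])
  also have "\<dots> = residue ?f t0 - residue (\<lambda>t. c / (t - t0)) t0"
    by (rule residue_diff[of "ball t0 r"]) (use r holr in \<open>auto intro!: holomorphic_intros\<close>)
  also have "residue (\<lambda>t. c / (t - t0)) t0 = c"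
    by (rule residue_simple[of UNIV]) auto
  finally have c: "c = of_int l0"
    by (simp add: res)
  define u where "u = (\<lambda>t. 1 / v t)"
  define \<phi> where "\<phi> = (\<lambda>t. (t - t0) powi (- l0 - int k) * u t * exp (- G t / (t - t0) ^ (m - 1)))"
  have v0': "v t \<noteq> 0" if "t \<in> ball t0 r" for t
    using v0[OF inc[OF that]] .
  have u: "u holomorphic_on ball t0 r"
    unfolding u_def by (intro holomorphic_intros holomorphic_on_subset[OF v] v0' subsetI inc)
  have Q1': "Q1 q b t = v t * (t - t0) ^ k" if "t \<in> ball t0 r" for t
    using Q1[OF inc[OF that]] .
  have "phi_branch n q a b t0 \<phi>"
    unfolding phi_branch_def
  proof (intro exI[of _ r] conjI ballI)
    show "\<phi> holomorphic_on ball t0 r - {t0}"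
      unfolding \<phi>_def
      by (intro holomorphic_intros holomorphic_on_subset[OF u] holomorphic_on_subset[OF G]) auto
    show "Q1 q b t \<noteq> 0" if "t \<in> ball t0 r - {t0}" for t
      using that v0' Q1' by auto
    fix s assume s: "s \<in> ball t0 r - {t0}"
    \<comment> \<open>On this disc around \<open>s\<close>, which avoids \<open>t0\<close>, the
      quotient \<open>(t - t0) / (s - t0)\<close> has distance less than 1 from 1. It therefore
      stays in the right half-plane, and the principal logarithm in \<open>L\<close> is holomorphic
      there.\<close>
    define U where "U = ball s (norm (s - t0)) \<inter> ball t0 r"
    define L where "L = (\<lambda>t. Ln ((t - t0) / (s - t0)) + Ln (s - t0))"
    define F where "F = (\<lambda>t. G t / (t - t0) ^ (m - 1) + of_int l0 * L t)"
    have t0U: "t0 \<notin> U"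
      by (simp add: U_def dist_norm)
    have "(F has_field_derivative ?f t) (at t) \<and> \<phi> t = 1 / Q1 q b t * exp (- F t)" if t: "t \<in> U" for t
    proof
      have tn: "t \<noteq> t0" "s \<noteq> t0" and tr: "t \<in> ball t0 r"
        using t t0U s by (auto simp: U_def)
      have "norm (1 - (t - t0) / (s - t0)) = norm (s - t) / norm (s - t0)"
        using tn by (simp add: norm_divide[symmetric] diff_divide_distrib[symmetric] diff_divide_eq_iff)
      also have "\<dots> < 1"
        using t tn by (simp add: U_def dist_norm)
      finally have "0 < Re ((t - t0) / (s - t0))"
        using abs_Re_le_cmod[of "1 - (t - t0) / (s - t0)"] by simp
      then have nr: "(t - t0) / (s - t0) \<notin> \<real>\<^sub>\<le>\<^sub>0"
        by (auto simp: complex_nonpos_Reals_iff)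
      have dL: "(L has_field_derivative 1 / (t - t0)) (at t)"
      proof -
        have "((\<lambda>t. (t - t0) / (s - t0)) has_field_derivative 1 / (s - t0)) (at t)"
          by (rule DERIV_cdivide) (auto intro!: derivative_eq_intros)
        from DERIV_chain2[OF has_field_derivative_Ln[OF nr] this]
        have "((\<lambda>t. Ln ((t - t0) / (s - t0))) has_field_derivative 1 / (t - t0)) (at t)"
          using tn by simp
        from DERIV_add[OF this DERIV_const] show ?thesis
          by (simp add: L_def)
      qed
      have "(F has_field_derivative (?f t - c / (t - t0)) + of_int l0 * (1 / (t - t0))) (at t)"
        unfolding F_def using tn tr by (intro DERIV_add[OF dG' DERIV_cmult[OF dL]]) blast
      then show "(F has_field_derivative ?f t) (at t)"
        by (simp add: c)
      have "exp (L t) = t - t0"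
        using tn by (simp add: L_def exp_add)
      then have "exp (- (of_int l0 * L t)) = (t - t0) powi (- l0)"
        using exp_power_int[of "L t" "- l0"] by simp
      then have "exp (- F t) = (t - t0) powi (- l0) * exp (- G t / (t - t0) ^ (m - 1))"
        by (simp add: F_def exp_diff exp_minus divide_inverse)
      then show "\<phi> t = 1 / Q1 q b t * exp (- F t)"
        using tn by (simp add: \<phi>_def u_def Q1'[OF tr] power_int_diff field_simps)
    qed
    moreover have "open U" "s \<in> U" "U \<subseteq> ball t0 r - {t0}"
      using s t0U by (auto simp: U_def)
    ultimately show "\<exists>U F. open U \<and> s \<in> U \<and> U \<subseteq> ball t0 r - {t0} \<and>
        (\<forall>t\<in>U. (F has_field_derivative ?f t) (at t) \<and> \<phi> t = 1 / Q1 q b t * exp (- F t))"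
      by blast
  qed (rule r)
  moreover have "k = m" if "Q0 n a t0 \<noteq> 0"
  proof -
    \<comment> \<open>If \<open>Q0\<close> does not vanish at \<open>t0\<close>, nothing cancels and
      the pole order is the full order \<open>k\<close> of the zero of \<open>Q1\<close>.\<close>
    have "zorder ?f t0 = - int k"
    proof (rule zorder_eqI)
      show "(\<lambda>t. Q0 n a t * u t) holomorphic_on ball t0 r"
        by (intro holomorphic_intros u)
      show "?f t = Q0 n a t * u t * (t - t0) powi (- int k)" if "t \<in> ball t0 r" for t
        using Q1'[OF that] by (simp add: u_def power_int_minus divide_inverse mult_ac)
    qed (use r v0' that in \<open>auto simp: u_def\<close>)
    then show ?thesis
      using pole_order by simp
  qed
  moreover have "u t \<noteq> 0" if "t \<in> ball t0 r" for t
    using v0'[OF that] by (simp add: u_def)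
  ultimately show thesis
    using that[of r u G \<phi> k] r(1) u G by (simp add: \<phi>_def)
qed

subsection \<open>The solution attached to a pole\<close>

lemma residue_sum:
  assumes "open S" "z \<in> S" "\<And>i. i \<in> I \<Longrightarrow> f i holomorphic_on S - {z}"
  shows "residue (\<lambda>t. \<Sum>i\<in>I. f i t) z = (\<Sum>i\<in>I. residue (f i) z)"
  using assms(3)
proof (induction I rule: infinite_finite_induct)
  case (insert i I)
  then show ?case
    by (simp add: residue_add[OF assms(1,2)] holomorphic_on_sum)
qed (simp_all add: residue_const)

text \<open>Each derivative in \<open>z\<close> multiplies the integrand by \<open>- t\<close>, so
  \<open>L\<close> produces the factor \<open>Q0 + z * Q1\<close>. By the equation for
  \<open>Q1 \<phi>\<close>, the resulting integrand is the derivative of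
  \<open>- Q1 \<phi> exp (- z t)\<close>.\<close>

lemma L_op_residue_eq_0:
  assumes q: "q < n" and b_zero: "\<And>j. j > q \<Longrightarrow> b j = 0" and \<phi>: "phi_branch n q a b t0 \<phi>"
  shows "L_op n a b (\<lambda>z. residue (\<lambda>t. \<phi> t * exp (- z * t)) t0) z = 0"
proof -
  obtain r where r: "0 < r" and hol: "\<phi> holomorphic_on ball t0 r - {t0}"
    and B: "\<forall>t\<in>ball t0 r - {t0}. Q1 q b t \<noteq> 0 \<and> \<phi> t \<noteq> 0 \<and>
      ((\<lambda>t. Q1 q b t * \<phi> t) has_field_derivative - (Q0 n a t * \<phi> t)) (at t)"
    using phi_branch_deriv[OF \<phi>] by blast
  define e where "e = (\<lambda>j t. (- t) ^ j * \<phi> t * exp (- z * t))"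
  have e: "e j holomorphic_on ball t0 r - {t0}" for j
    unfolding e_def by (intro holomorphic_intros hol)
  have deriv: "(deriv ^^ j) (\<lambda>z. residue (\<lambda>t. \<phi> t * exp (- z * t)) t0) z = residue (e j) t0" for j
    using higher_deriv_residue_exp[OF hol r, where c = 0] by (simp add: e_def)
  \<comment> \<open>Padding with the zero coefficients beyond \<open>q\<close> gives
    \<open>Q1\<close> the same summation range as \<open>L_op\<close>.\<close>
  have Q1: "Q1 q b t = (\<Sum>j<n. b j * (- t) ^ j)" for t
    unfolding Q1_def using q b_zero by (intro sum.mono_neutral_left) auto
  have "L_op n a b (\<lambda>z. residue (\<lambda>t. \<phi> t * exp (- z * t)) t0) z
      = residue (e n) t0 + (\<Sum>j<n. residue (\<lambda>t. (a j + b j * z) * e j t) t0)"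
    unfolding L_op_def deriv using r by (simp add: residue_lmul[OF _ _ e])
  also have "\<dots> = residue (\<lambda>t. e n t + (\<Sum>j<n. (a j + b j * z) * e j t)) t0"
    using r by (simp add: residue_add[of "ball t0 r"] residue_sum[of "ball t0 r"] e holomorphic_on_sum
        holomorphic_on_mult)
  also have "\<dots> = residue (\<lambda>t. Q0 n a t * \<phi> t * exp (- z * t) + z * (Q1 q b t * \<phi> t * exp (- z * t))) t0"
  proof (rule arg_cong[where f = "\<lambda>f. residue f t0"], rule ext)
    fix t
    show "e n t + (\<Sum>j<n. (a j + b j * z) * e j t)
        = Q0 n a t * \<phi> t * exp (- z * t) + z * (Q1 q b t * \<phi> t * exp (- z * t))"
      unfolding Q0_def Q1 e_def
      by (simp add: distrib_right distrib_left sum.distrib sum_distrib_left sum_distrib_right mult_ac)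
  qed
  also have "\<dots> = 0"
  proof (rule residue_deriv_eq_0[OF r])
    fix t assume "t \<in> ball t0 r - {t0}"
    note dt = B[rule_format, OF this, THEN conjunct2, THEN conjunct2]
    have "((\<lambda>t. exp (- z * t)) has_field_derivative exp (- z * t) * (- z)) (at t)"
      by (auto intro!: derivative_eq_intros)
    from DERIV_minus[OF DERIV_mult[OF dt this]]
    show "((\<lambda>t. - (Q1 q b t * \<phi> t * exp (- z * t))) has_field_derivative
        Q0 n a t * \<phi> t * exp (- z * t) + z * (Q1 q b t * \<phi> t * exp (- z * t))) (at t)"
      by (rule back_subst[of "\<lambda>D. (_ has_field_derivative D) _"]) (simp add: algebra_simps)
  qed
  finally show ?thesis .
qed

text \<open>The \<open>j\<close>-th derivative at 0 multiplies the integrand by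
  \<open>(- (t - t0)) ^ j\<close>. For \<open>j > d\<close> this cancels the pole, and for
  \<open>j = d\<close> it leaves a simple pole with residue \<open>(- 1) ^ d * U t0\<close>, so the
  Taylor series stops exactly at degree \<open>d\<close>.\<close>

lemma residue_exp_polynomial:
  assumes U: "U holomorphic_on ball t0 r" and r: "0 < r" and U0: "U t0 \<noteq> 0"
  obtains p where "\<And>z. residue (\<lambda>t. U t / (t - t0) ^ Suc d * exp (- z * (t - t0))) t0 = poly p z"
    "p \<noteq> 0" "degree p = d"
proof -
  define W where "W = (\<lambda>z. residue (\<lambda>t. U t / (t - t0) ^ Suc d * exp (- z * (t - t0))) t0)"
  have hol: "(\<lambda>t. U t / (t - t0) ^ Suc d) holomorphic_on ball t0 r - {t0}"
    by (intro holomorphic_intros holomorphic_on_subset[OF U]) auto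
  have deriv: "(deriv ^^ j) W 0 = residue (\<lambda>t. (- (t - t0)) ^ j * (U t / (t - t0) ^ Suc d)) t0" for j
    unfolding W_def higher_deriv_residue_exp[OF hol r] by simp
  have ne: "\<forall>\<^sub>F t in at t0. t \<noteq> t0"
    by (rule eventually_neq_at_within)
  have 0: "(deriv ^^ j) W 0 = 0" if j: "j > d" for j
  proof -
    have "(deriv ^^ j) W 0 = residue (\<lambda>t. (- 1) ^ j * (t - t0) ^ (j - Suc d) * U t) t0"
      unfolding deriv
    proof (rule residue_cong)
      show "\<forall>\<^sub>F t in at t0. (- (t - t0)) ^ j * (U t / (t - t0) ^ Suc d) = (- 1) ^ j * (t - t0) ^ (j - Suc d) * U t"
        using ne
      proof eventually_elim
        case (elim t)
        have "(- (t - t0)) ^ j = (- 1) ^ j * (t - t0) ^ j"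
          by (rule power_minus)
        also have "(t - t0) ^ j = (t - t0) ^ (j - Suc d) * (t - t0) ^ Suc d"
          unfolding power_add[symmetric] using j by simp
        finally show ?case
          using elim by (simp only: mult.assoc nonzero_mult_div_cancel_left) simp
      qed
    qed simp
    also have "\<dots> = 0"
      using r by (intro residue_holo[of "ball t0 r"] holomorphic_intros U) auto
    finally show ?thesis .
  qed
  have "(deriv ^^ d) W 0 = residue (\<lambda>t. (- 1) ^ d * U t / (t - t0)) t0"
    unfolding deriv
  proof (rule residue_cong)
    show "\<forall>\<^sub>F t in at t0. (- (t - t0)) ^ d * (U t / (t - t0) ^ Suc d) = (- 1) ^ d * U t / (t - t0)"
      using ne
    proof eventually_elim
      case (elim t)
      have "(- (t - t0)) ^ d = (- 1) ^ d * (t - t0) ^ d"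
        by (rule power_minus)
      then show ?case
        using elim by (simp only:) simp
    qed
  qed simp
  also have "\<dots> = (- 1) ^ d * U t0"
    using r by (intro residue_simple[of "ball t0 r"] holomorphic_intros U) auto
  finally have d: "(deriv ^^ d) W 0 \<noteq> 0"
    using U0 by simp
  define p where "p = (\<Sum>i\<le>d. monom ((deriv ^^ i) W 0 / fact i) i)"
  have "W holomorphic_on UNIV"
    unfolding W_def by (rule holomorphic_residue_exp[OF hol r])
  then have W: "W z = poly p z" for z
    unfolding p_def by (rule entire_polynomial_if_higher_deriv_0[OF _ 0])
  have "coeff p d \<noteq> 0"
    using d by (simp add: p_def coeff_sum)
  moreover have "degree p \<le> d"
    unfolding p_def by (intro degree_sum_le) (auto intro: order_trans[OF degree_monom_le])
  ultimately have "p \<noteq> 0" "degree p = d"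
    by (auto intro: antisym le_degree)
  with W show thesis
    unfolding W_def by (rule that)
qed

text \<open>If \<open>W\<close> were a polynomial, \<open>(t - t0)\<^sup>J \<phi>\<close> would extend holomorphically to \<open>t0\<close> for large \<open>J\<close>;
  then \<open>Q0 / Q1\<close>, minus the logarithmic derivative of \<open>Q1 \<phi>\<close>, would have at most a simple pole.\<close>

lemma residue_exp_not_polynomial:
  assumes \<phi>: "phi_branch n q a b t0 \<phi>"
    and pole: "is_pole (\<lambda>t. Q0 n a t / Q1 q b t) t0"
    and pole_order: "zorder (\<lambda>t. Q0 n a t / Q1 q b t) t0 = - int m" and m: "m > 1"
  shows "\<nexists>p. \<forall>z. residue (\<lambda>t. \<phi> t * exp (- z * (t - t0))) t0 = poly p z"
proof
  assume "\<exists>p. \<forall>z. residue (\<lambda>t. \<phi> t * exp (- z * (t - t0))) t0 = poly p z"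
  then obtain p where p: "(\<lambda>z. residue (\<lambda>t. \<phi> t * exp (- z * (t - t0))) t0) = poly p"
    by auto
  obtain r where r: "0 < r" and hol: "\<phi> holomorphic_on ball t0 r - {t0}"
    and B: "\<forall>t\<in>ball t0 r - {t0}. Q1 q b t \<noteq> 0 \<and> \<phi> t \<noteq> 0 \<and>
      ((\<lambda>t. Q1 q b t * \<phi> t) has_field_derivative - (Q0 n a t * \<phi> t)) (at t)"
    using phi_branch_deriv[OF \<phi>] by blast
  have Q1: "Q1 q b t \<noteq> 0" and \<phi>0: "\<phi> t \<noteq> 0"
    and d: "((\<lambda>t. Q1 q b t * \<phi> t) has_field_derivative - (Q0 n a t * \<phi> t)) (at t)"
    if "t \<in> ball t0 r - {t0}" for t
    using bspec[OF B that] by blast+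
  let ?f = "\<lambda>t. Q0 n a t / Q1 q b t"
  \<comment> \<open>Derivatives of order at least \<open>J\<close> annihilate \<open>p\<close>; up
    to sign, their values at 0 are the moments of \<open>(t - t0) ^ J * \<phi> t\<close>, so all of
    these vanish.\<close>
  define J where "J = Suc (degree p)"
  have hJ: "(\<lambda>t. (t - t0) ^ J * \<phi> t) holomorphic_on ball t0 r - {t0}"
    by (intro holomorphic_intros hol)
  have "residue (\<lambda>t. (t - t0) ^ i * ((t - t0) ^ J * \<phi> t)) t0 = 0" for i
  proof -
    have "(deriv ^^ (i + J)) (poly p) = (\<lambda>_. 0)"
      by (rule higher_deriv_poly_eq_0) (simp add: J_def)
    then have "residue (\<lambda>t. (- (t - t0)) ^ (i + J) * \<phi> t) t0 = 0"
      unfolding p[symmetric] higher_deriv_residue_exp[OF hol r] by (auto dest: fun_cong[where x = 0])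
    moreover have "(\<lambda>t. (- (t - t0)) ^ (i + J) * \<phi> t)
        = (\<lambda>t. (- 1) ^ (i + J) * ((t - t0) ^ i * ((t - t0) ^ J * \<phi> t)))"
      by (simp add: power_minus[of "_ - t0"] power_add mult_ac del: minus_diff_eq)
    moreover have "residue (\<lambda>t. (- 1) ^ (i + J) * ((t - t0) ^ i * ((t - t0) ^ J * \<phi> t))) t0
        = (- 1) ^ (i + J) * residue (\<lambda>t. (t - t0) ^ i * ((t - t0) ^ J * \<phi> t)) t0"
      using r by (intro residue_lmul[of "ball t0 r"] holomorphic_intros hJ) auto
    ultimately show ?thesis by simp
  qed
  then obtain h where h: "h holomorphic_on ball t0 (r/2)"
    and h_eq: "\<And>z. z \<in> ball t0 (r/2) - {t0} \<Longrightarrow> h z = (z - t0) ^ J * \<phi> z"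
    using holomorphic_extension_if_residues_0[OF hJ, of "r/2"] r by auto
  define X where "X = (\<lambda>t. Q1 q b t * h t)"
  have Xhol: "X holomorphic_on ball t0 (r/2)"
    unfolding X_def by (intro holomorphic_intros h)
  have "t0 + of_real (r / 4) \<in> ball t0 (r/2) - {t0}"
    using r by (auto simp: dist_norm)
  moreover have half: "t \<in> ball t0 r - {t0}" if "t \<in> ball t0 (r/2) - {t0}" for t
    using that r by auto
  moreover have "X t \<noteq> 0" if "t \<in> ball t0 (r/2) - {t0}" for t
    using that h_eq[OF that] Q1[OF half[OF that]] \<phi>0[OF half[OF that]] by (auto simp: X_def)
  ultimately have ex: "\<exists>w\<in>ball t0 (r/2). X w \<noteq> 0"
    by blast
  have t0half: "t0 \<in> ball t0 (r/2)"
    using r by simp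
  define e where "e = zor_poly X t0"
  define k where "k = nat (zorder X t0)"
  obtain R where R: "0 < R" "cball t0 R \<subseteq> ball t0 (r/2)" and e: "e holomorphic_on cball t0 R"
    and Xe: "\<forall>w\<in>cball t0 R. X w = e w * (w - t0) ^ k \<and> e w \<noteq> 0"
    using zorder_exist_zero[OF Xhol open_ball connected_ball t0half ex] unfolding e_def k_def by blast
  have eb: "e holomorphic_on ball t0 R"
    by (rule holomorphic_on_subset[OF e]) auto
  \<comment> \<open>The logarithmic derivative of \<open>X\<close> computed twice: the product with
    \<open>Q1 \<phi>\<close> gives \<open>J / (t - t0) - Q0 / Q1\<close>, and the factorisation
    \<open>e t * (t - t0) ^ k\<close> gives \<open>deriv e t / e t + k / (t - t0)\<close>.\<close>
  have key: "(t - t0) * ?f t = of_nat J - of_nat k - (t - t0) * deriv e t / e t"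
    if t: "t \<in> ball t0 R - {t0}" for t
  proof -
    have t': "t \<in> ball t0 (r/2) - {t0}"
      using t R(2) ball_subset_cball[of t0 R] by blast
    note t'' = half[OF t']
    have tn: "t \<noteq> t0" using t by auto
    have J': "(t - t0) ^ J = (t - t0) * (t - t0) ^ (J - 1)"
      by (simp add: J_def)
    have "((\<lambda>t. (t - t0) ^ J) has_field_derivative of_nat J * (t - t0) ^ (J - 1)) (at t)"
      by (auto intro!: derivative_eq_intros)
    from DERIV_mult[OF this d[OF t'']]
    have "((\<lambda>t. (t - t0) ^ J * (Q1 q b t * \<phi> t)) has_field_derivative
        of_nat J * (t - t0) ^ (J - 1) * (Q1 q b t * \<phi> t) - Q0 n a t * \<phi> t * (t - t0) ^ J) (at t)"
      by simp
    then have 1: "(X has_field_derivative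
        of_nat J * (t - t0) ^ (J - 1) * (Q1 q b t * \<phi> t) - Q0 n a t * \<phi> t * (t - t0) ^ J) (at t)"
      by (rule has_field_derivative_transform_within_open[where S = "ball t0 (r/2) - {t0}"])
         (use t' h_eq in \<open>auto simp: X_def intro: open_delete\<close>)
    have "(e has_field_derivative deriv e t) (at t)"
      using holomorphic_derivI[OF eb open_ball] t by auto
    moreover have "((\<lambda>t. (t - t0) ^ k) has_field_derivative of_nat k * (t - t0) ^ (k - 1)) (at t)"
      by (auto intro!: derivative_eq_intros)
    ultimately have "((\<lambda>t. e t * (t - t0) ^ k) has_field_derivative
        deriv e t * (t - t0) ^ k + of_nat k * (t - t0) ^ (k - 1) * e t) (at t)"
      by (rule DERIV_mult)
    then have 2: "(X has_field_derivative deriv e t * (t - t0) ^ k + of_nat k * (t - t0) ^ (k - 1) * e t) (at t)"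
      by (rule has_field_derivative_transform_within_open[where S = "ball t0 R"])
         (use t Xe in auto)
    have X1: "X t = (t - t0) ^ J * (Q1 q b t * \<phi> t)"
      using h_eq[OF t'] by (simp add: X_def)
    have X2: "X t = e t * (t - t0) ^ k" and e0: "e t \<noteq> 0"
      using Xe t by auto
    have l1: "(t - t0) * (of_nat J * (t - t0) ^ (J - 1) * (Q1 q b t * \<phi> t)) = of_nat J * X t"
      unfolding X1 J' by (simp only: mult_ac)
    have l2: "(t - t0) * (Q0 n a t * \<phi> t * (t - t0) ^ J) = (t - t0) * ?f t * X t"
      using Q1[OF t''] by (simp add: X1)
    have r1: "(t - t0) * (deriv e t * (t - t0) ^ k) = (t - t0) * deriv e t / e t * X t"
      using e0 by (simp add: X2)
    have r2: "(t - t0) * (of_nat k * (t - t0) ^ (k - 1) * e t) = of_nat k * X t"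
      unfolding X2 by (cases k) auto
    have "(t - t0) * (of_nat J * (t - t0) ^ (J - 1) * (Q1 q b t * \<phi> t) - Q0 n a t * \<phi> t * (t - t0) ^ J)
        = (t - t0) * (deriv e t * (t - t0) ^ k + of_nat k * (t - t0) ^ (k - 1) * e t)"
      unfolding DERIV_unique[OF 1 2] ..
    then have "of_nat J * X t - (t - t0) * ?f t * X t = (t - t0) * deriv e t / e t * X t + of_nat k * X t"
      by (simp only: right_diff_distrib[of "t - t0"] distrib_left[of "t - t0"] l1 l2 r1 r2)
    then have "(of_nat J - (t - t0) * ?f t) * X t = ((t - t0) * deriv e t / e t + of_nat k) * X t"
      by (simp only: left_diff_distrib distrib_right)
    moreover have "X t \<noteq> 0"
      using X2 e0 tn by simp
    ultimately have "of_nat J - (t - t0) * ?f t = (t - t0) * deriv e t / e t + of_nat k"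
      by (simp only: mult_cancel_right) simp
    then show ?thesis
      by (simp add: algebra_simps)
  qed
  have e0: "e t0 \<noteq> 0" "t0 \<in> ball t0 R"
    using Xe R by auto
  have lim_e: "(e \<longlongrightarrow> e t0) (at t0)" "(deriv e \<longlongrightarrow> deriv e t0) (at t0)"
    using holomorphic_on_imp_continuous_on[OF eb] holomorphic_on_imp_continuous_on[OF holomorphic_deriv[OF eb open_ball]] e0(2)
    by (auto simp: continuous_on_eq_continuous_at isCont_def)
  have "((\<lambda>t. of_nat J - of_nat k - (t - t0) * deriv e t / e t) \<longlongrightarrow>
      of_nat J - of_nat k - (t0 - t0) * deriv e t0 / e t0) (at t0)"
    by (intro tendsto_intros lim_e e0)
  then have lim0: "((\<lambda>t. of_nat J - of_nat k - (t - t0) * deriv e t / e t) \<longlongrightarrow> of_nat J - of_nat k) (at t0)"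
    by (simp only: diff_self mult_zero_left div_0 diff_zero)
  have lim: "((\<lambda>t. (t - t0) * ?f t) \<longlongrightarrow> of_nat J - of_nat k) (at t0)"
  proof (rule Lim_transform_eventually[OF lim0])
    have "of_nat J - of_nat k - (t - t0) * deriv e t / e t = (t - t0) * ?f t"
      if "t \<noteq> t0" "dist t t0 < R" for t
      using key[of t] that by (simp add: dist_commute)
    then show "\<forall>\<^sub>F t in at t0. of_nat J - of_nat k - (t - t0) * deriv e t / e t = (t - t0) * ?f t"
      unfolding eventually_at using R(1) by blast
  qed
  have fhol: "?f holomorphic_on ball t0 r - {t0}"
    by (intro holomorphic_intros Q1)
  obtain g s where s: "0 < s" and g: "g holomorphic_on cball t0 s" "g t0 \<noteq> 0"
    and fg: "\<forall>t\<in>cball t0 s - {t0}. ?f t = g t / (t - t0) ^ m"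
    using zorder_exist_pole[OF fhol _ _ pole] r pole_order by auto
  \<comment> \<open>Because \<open>m > 1\<close>, the extra factor tends to 0 while
    \<open>(t - t0) * ?f t\<close> stays bounded; but the product equals \<open>g\<close>, whose
    value at \<open>t0\<close> is non-zero.\<close>
  have "((\<lambda>t. (t - t0) ^ (m - 1) * ((t - t0) * ?f t)) \<longlongrightarrow> (t0 - t0) ^ (m - 1) * (of_nat J - of_nat k)) (at t0)"
    by (intro tendsto_mult lim tendsto_intros)
  then have "(g \<longlongrightarrow> (t0 - t0) ^ (m - 1) * (of_nat J - of_nat k)) (at t0)"
  proof (rule Lim_transform_eventually)
    have "(t - t0) ^ (m - 1) * ((t - t0) * ?f t) = g t" if "t \<noteq> t0" "dist t t0 < s" for t
    proof -
      have "(t - t0) ^ (m - 1) * ((t - t0) * ?f t) = (t - t0) ^ Suc (m - 1) * ?f t"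
        by (simp only: power_Suc mult_ac)
      also have "\<dots> = (t - t0) ^ m * (g t / (t - t0) ^ m)"
        using fg that m by (simp add: dist_commute)
      finally show ?thesis using that by simp
    qed
    then show "\<forall>\<^sub>F t in at t0. (t - t0) ^ (m - 1) * ((t - t0) * ?f t) = g t"
      unfolding eventually_at using s by blast
  qed
  moreover have "(g \<longlongrightarrow> g t0) (at t0)"
    using holomorphic_on_imp_continuous_on[OF holomorphic_on_subset[OF g(1) ball_subset_cball]] s
    by (auto simp: continuous_on_eq_continuous_at isCont_def)
  ultimately have "(t0 - t0) ^ (m - 1) * (of_nat J - of_nat k) = g t0"
    by (rule tendsto_unique[OF at_neq_bot])
  then show False
    using g(2) m by (auto simp: power_0_left)
qed

section \<open>Bounds and normal form of a branch near the pole\<close>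

lemma power_le_fact_mult_exp:
  fixes x :: real
  assumes "0 \<le> x"
  shows "x ^ n \<le> fact n * exp x"
proof -
  have "(\<Sum>k\<in>{n}. x ^ k /\<^sub>R fact k) \<le> exp x"
    unfolding exp_def using assms by (intro sum_le_suminf summable_exp_generic) auto
  then show ?thesis
    by (simp add: field_simps)
qed

text \<open>The power factor is absorbed into the exponential: for \<open>\<rho> \<le> 1\<close> it
  is at most \<open>(1 / \<rho>) ^ M\<close>, hence at most
  \<open>fact M * exp (1 / \<rho>)\<close>, and \<open>1 / \<rho> \<le> 1 / \<rho> ^ p\<close> since
  \<open>p > 0\<close>. This costs only 1 in the exponent constant.\<close>

lemma power_int_mult_exp_bound:
  assumes u: "u holomorphic_on ball t0 r" and G: "G holomorphic_on ball t0 r" and r: "0 < r" and p: "p > 0"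
  obtains C K r' where "0 < r'" "r' \<le> r" "0 \<le> K"
    "\<forall>t\<in>ball t0 r' - {t0}.
      norm ((t - t0) powi N * u t * exp (- G t / (t - t0) ^ p)) \<le> C * exp (K / norm (t - t0) ^ p)"
proof -
  define r' where "r' = min 1 (r / 2)"
  have r': "0 < r'" "r' \<le> 1" "r' \<le> r" "cball t0 r' \<subseteq> ball t0 r"
    using r by (auto simp: r'_def)
  have bdd: "bounded (f ` cball t0 r')" if "f holomorphic_on ball t0 r" for f :: "complex \<Rightarrow> complex"
    by (intro compact_imp_bounded compact_continuous_image holomorphic_on_imp_continuous_on
        holomorphic_on_subset[OF that] r') simp
  obtain A where A: "\<forall>t\<in>cball t0 r'. norm (u t) \<le> A"
    using bdd[OF u] by (auto simp: bounded_iff)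
  obtain B where B: "\<forall>t\<in>cball t0 r'. norm (G t) \<le> B"
    using bdd[OF G] by (auto simp: bounded_iff)
  define M where "M = nat \<bar>N\<bar>"
  have B0: "0 \<le> B"
    using B r' by (metis centre_in_cball less_imp_le norm_ge_zero order_trans)
  have "norm ((t - t0) powi N * u t * exp (- G t / (t - t0) ^ p))
      \<le> (fact M * A) * exp ((B + 1) / norm (t - t0) ^ p)" if t: "t \<in> ball t0 r' - {t0}" for t
  proof -
    define \<rho> where "\<rho> = norm (t - t0)"
    have \<rho>: "0 < \<rho>" "\<rho> \<le> 1"
      using t r' by (auto simp: \<rho>_def dist_norm norm_minus_commute)
    have tc: "t \<in> cball t0 r'"
      using t by auto
    have "\<rho> powi N \<le> (1 / \<rho>) ^ M"
    proof (cases "N \<ge> 0")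
      case True
      then have "\<rho> powi N = \<rho> ^ M"
        by (simp add: M_def power_int_def)
      also have "\<dots> \<le> 1"
        using \<rho> by (intro power_le_one) auto
      also have "1 \<le> (1 / \<rho>) ^ M"
        using \<rho> by (intro one_le_power) auto
      finally show ?thesis .
    next
      case False
      then show ?thesis
        by (simp add: M_def power_int_def field_simps)
    qed
    also have "\<dots> \<le> fact M * exp (1 / \<rho>)"
      using \<rho> by (intro power_le_fact_mult_exp) auto
    also have "\<dots> \<le> fact M * exp (1 / \<rho> ^ p)"
    proof -
      have "\<rho> ^ p \<le> \<rho> ^ 1"
        using \<rho> p by (intro power_decreasing) auto
      then show ?thesis
        using \<rho> by (simp add: frac_le)
    qed
    finally have 1: "norm ((t - t0) powi N) \<le> fact M * exp (1 / \<rho> ^ p)"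
      by (simp add: norm_power_int \<rho>_def)
    have "norm (exp (- G t / (t - t0) ^ p)) \<le> exp (norm (- G t / (t - t0) ^ p))"
      by (rule norm_exp)
    also have "norm (- G t / (t - t0) ^ p) \<le> B / \<rho> ^ p"
      using bspec[OF B tc] \<rho> by (simp add: norm_divide norm_power \<rho>_def divide_right_mono)
    finally have 2: "norm (exp (- G t / (t - t0) ^ p)) \<le> exp (B / \<rho> ^ p)"
      by simp
    have "norm ((t - t0) powi N * u t * exp (- G t / (t - t0) ^ p))
        \<le> (fact M * exp (1 / \<rho> ^ p)) * A * exp (B / \<rho> ^ p)"
      unfolding norm_mult using bspec[OF A tc] 1 2 by (intro mult_mono') auto
    also have "\<dots> = (fact M * A) * exp ((B + 1) / \<rho> ^ p)"
      by (simp add: add_divide_distrib exp_add mult_ac)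
    finally show ?thesis
      by (simp add: \<rho>_def)
  qed
  then show thesis
    using that[of r' "B + 1" "fact M * A"] r' B0 by simp
qed

lemma residue_cong_punctured_ball:
  assumes "0 < r" "\<And>t. t \<in> ball t0 r - {t0} \<Longrightarrow> f t = g t"
  shows "residue f t0 = residue g t0"
  using assms by (intro residue_cong) (auto simp: eventually_at dist_commute intro!: exI[of _ r])

text \<open>An arbitrary branch is a non-zero multiple of the explicit one, and the multiple is
  absorbed into \<open>u\<close>.\<close>

lemma phi_branch_normal_form:
  assumes pole: "is_pole (\<lambda>t. Q0 n a t / Q1 q b t) t0"
    and pole_order: "zorder (\<lambda>t. Q0 n a t / Q1 q b t) t0 = - int m"
    and res: "residue (\<lambda>t. Q0 n a t / Q1 q b t) t0 = of_int l0"
    and \<phi>: "phi_branch n q a b t0 \<phi>"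
  obtains r k u G where "0 < r" "u holomorphic_on ball t0 r" "G holomorphic_on ball t0 r" "u t0 \<noteq> 0"
    "\<forall>t\<in>ball t0 r - {t0}. \<phi> t = (t - t0) powi (- l0 - int k) * u t * exp (- G t / (t - t0) ^ (m - 1))"
    "Q0 n a t0 \<noteq> 0 \<longrightarrow> k = m"
proof (rule phi_branch_exists[OF pole pole_order res])
  fix r k u G \<psi>
  assume r: "0 < r" and u: "u holomorphic_on ball t0 r" and G: "G holomorphic_on ball t0 r"
    and u0: "\<And>t. t \<in> ball t0 r \<Longrightarrow> u t \<noteq> 0"
    and \<psi>: "\<And>t. \<psi> t = (t - t0) powi (- l0 - int k) * u t * exp (- G t / (t - t0) ^ (m - 1))"
    and br: "phi_branch n q a b t0 \<psi>" and k: "Q0 n a t0 \<noteq> 0 \<Longrightarrow> k = m"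
  show thesis
  proof (rule phi_branch_unique[OF \<phi> br])
    fix r' c assume r': "0 < r'" and c: "c \<noteq> 0" and eq: "\<And>t. t \<in> ball t0 r' - {t0} \<Longrightarrow> \<phi> t = c * \<psi> t"
    show thesis
    proof (rule that)
      show "0 < min r r'" using r r' by simp
      show "(\<lambda>t. c * u t) holomorphic_on ball t0 (min r r')"
        by (intro holomorphic_intros holomorphic_on_subset[OF u]) auto
      show "G holomorphic_on ball t0 (min r r')"
        by (rule holomorphic_on_subset[OF G]) auto
      show "c * u t0 \<noteq> 0"
        using c u0 r by simp
      show "\<forall>t\<in>ball t0 (min r r') - {t0}. \<phi> t
          = (t - t0) powi (- l0 - int k) * (c * u t) * exp (- G t / (t - t0) ^ (m - 1))"
        using eq by (auto simp: \<psi>)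
    qed (use k in blast)
  qed
qed

text \<open>The existence clause keeps the quantification over branches from being vacuous. The
  degree claims assume \<open>Q0 n a t0 \<noteq> 0\<close>, that is, no cancellation in
  \<open>Q0 / Q1\<close> at \<open>t0\<close>: a common zero makes the order \<open>k\<close> of
  \<open>Q1\<close> exceed \<open>m\<close>, and for \<open>m = 1\<close> the degree is
  \<open>l0 + k - 1\<close> whenever this is non-negative.\<close>

theorem theorem5:
  fixes n q m :: nat and a b :: "nat \<Rightarrow> complex" and t0 :: complex and l0 :: int
  assumes n: "n \<ge> 1" and q: "q \<le> n - 1"
    and nontriv: "\<not> (\<forall>z. a 0 + b 0 * z = 0)"
    and b_zero: "\<And>j. j > q \<Longrightarrow> b j = 0"
    and b_q: "b q = (-1) ^ (n - q + 1)"
    and t0: "t0 \<noteq> 0"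
    and pole: "is_pole (\<lambda>t. Q0 n a t / Q1 q b t) t0"
    and pole_order: "zorder (\<lambda>t. Q0 n a t / Q1 q b t) t0 = - int m"
    and res: "residue (\<lambda>t. Q0 n a t / Q1 q b t) t0 = of_int l0"
  shows "(\<exists>\<phi>. phi_branch n q a b t0 \<phi>) \<and>
    (\<forall>\<phi> w. phi_branch n q a b t0 \<phi> \<longrightarrow>
       w = (\<lambda>z. residue (\<lambda>t. \<phi> t * exp (- z * t)) t0) \<longrightarrow>
       w holomorphic_on UNIV \<and> (\<forall>z. L_op n a b w z = 0) \<and>
       (\<exists>W. (\<forall>z. w z = exp (- t0 * z) * W z) \<and>
          (m > 1 \<longrightarrow> transcendental_entire W \<and> growth_order W \<le> ereal (1 - 1 / real m)) \<and>
          (m = 1 \<longrightarrow> (\<exists>p. (\<forall>z. W z = poly p z) \<and>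
             (Q0 n a t0 \<noteq> 0 \<longrightarrow>
                (l0 \<ge> 0 \<longrightarrow> p \<noteq> 0 \<and> int (degree p) = l0) \<and>
                (l0 < 0 \<longrightarrow> p = 0))))))"
proof (intro conjI allI impI)
  show "\<exists>\<phi>. phi_branch n q a b t0 \<phi>"
    by (rule phi_branch_exists[OF pole pole_order res], rule exI)
next
  fix \<phi> w
  assume \<phi>: "phi_branch n q a b t0 \<phi>" and w: "w = (\<lambda>z. residue (\<lambda>t. \<phi> t * exp (- z * t)) t0)"
  have qn: "q < n" using n q by simp
  obtain r0 where r0: "0 < r0" and hol: "\<phi> holomorphic_on ball t0 r0 - {t0}"
    using phi_branch_deriv[OF \<phi>] by blast
  show "w holomorphic_on UNIV"
    using holomorphic_residue_exp[OF hol r0, of 0] by (simp add: w)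
  show "L_op n a b w z = 0" for z
    unfolding w by (rule L_op_residue_eq_0[OF qn b_zero \<phi>])
  define W where "W = (\<lambda>z. residue (\<lambda>t. \<phi> t * exp (- z * (t - t0))) t0)"
  obtain r k u G where r: "0 < r" and u: "u holomorphic_on ball t0 r" and G: "G holomorphic_on ball t0 r"
    and u0: "u t0 \<noteq> 0"
    and nf: "\<forall>t\<in>ball t0 r - {t0}. \<phi> t = (t - t0) powi (- l0 - int k) * u t * exp (- G t / (t - t0) ^ (m - 1))"
    and k: "Q0 n a t0 \<noteq> 0 \<longrightarrow> k = m"
    by (rule phi_branch_normal_form[OF pole pole_order res \<phi>])
  have wW: "w z = exp (- t0 * z) * W z" for z
  proof -
    have "w z = residue (\<lambda>t. exp (- t0 * z) * (\<phi> t * exp (- z * (t - t0)))) t0"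
      unfolding w by (rule arg_cong[where f = "\<lambda>f. residue f t0"])
        (simp add: fun_eq_iff exp_add[symmetric] algebra_simps)
    also have "\<dots> = exp (- t0 * z) * W z"
      unfolding W_def using r0 by (intro residue_lmul[of "ball t0 r0"] holomorphic_intros hol) auto
    finally show ?thesis .
  qed
  have "transcendental_entire W \<and> growth_order W \<le> ereal (1 - 1 / real m)" if m: "m > 1"
  proof
    have "W holomorphic_on UNIV"
      unfolding W_def by (rule holomorphic_residue_exp[OF hol r0])
    then show te: "transcendental_entire W"
      using residue_exp_not_polynomial[OF \<phi> pole pole_order m] unfolding transcendental_entire_def W_def
      by blast
    have "m - 1 > 0" using m by simp
    then obtain C K r' where r': "0 < r'" "r' \<le> r" and K: "0 \<le> K"
      and bound: "\<forall>t\<in>ball t0 r' - {t0}.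
        norm ((t - t0) powi (- l0 - int k) * u t * exp (- G t / (t - t0) ^ (m - 1)))
          \<le> C * exp (K / norm (t - t0) ^ (m - 1))"
      by (rule power_int_mult_exp_bound[OF u G r])
    define s where "s = min r0 r'"
    have s: "0 < s" "s \<le> r0" "s \<le> r'" using r0 r' by (auto simp: s_def)
    have "\<forall>\<^sub>F x in at_top. \<forall>z. norm z = x \<longrightarrow>
        norm (W z) \<le> exp ((K + 1) * x powr (1 - 1 / real (Suc (m - 1))))"
      unfolding W_def
    proof (rule residue_exp_growth)
      show "\<phi> holomorphic_on ball t0 s - {t0}"
        by (rule holomorphic_on_subset[OF hol]) (use s in auto)
      show "norm (\<phi> t) \<le> C * exp (K / norm (t - t0) ^ (m - 1))" if "t \<in> ball t0 s - {t0}" for t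
      proof -
        have "t \<in> ball t0 r - {t0}" "t \<in> ball t0 r' - {t0}"
          using that s r' by auto
        then show ?thesis
          using nf bound by simp
      qed
    qed (rule s)
    then show "growth_order W \<le> ereal (1 - 1 / real m)"
      using K m by (intro growth_order_le[OF te, of "K + 1"]) auto
  qed
  moreover have "\<exists>p. (\<forall>z. W z = poly p z) \<and>
      (Q0 n a t0 \<noteq> 0 \<longrightarrow> (l0 \<ge> 0 \<longrightarrow> p \<noteq> 0 \<and> int (degree p) = l0) \<and> (l0 < 0 \<longrightarrow> p = 0))"
    if m: "m = 1"
  proof -
    \<comment> \<open>For \<open>m = 1\<close> the denominator \<open>(t - t0) ^ (m - 1)\<close> is
      1, so the exponential is holomorphic at \<open>t0\<close> and \<open>\<phi>\<close> is an
      integer power times a non-vanishing factor.\<close>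
    define U where "U = (\<lambda>t. u t * exp (- G t))"
    have U: "U holomorphic_on ball t0 r"
      unfolding U_def by (intro holomorphic_intros u G)
    have U0: "U t0 \<noteq> 0" using u0 by (simp add: U_def)
    have \<phi>U: "\<phi> t = (t - t0) powi (- l0 - int k) * U t" if "t \<in> ball t0 r - {t0}" for t
      using bspec[OF nf that] by (simp add: m U_def)
    show ?thesis
    \<comment> \<open>The sign of the exponent decides: either \<open>\<phi>\<close> extends
      holomorphically and every residue is zero, or it has a pole of order \<open>l0 + k\<close>.
      Without cancellation \<open>k = 1\<close>, so the cases become \<open>l0 < 0\<close> and
      \<open>l0 \<ge> 0\<close>.\<close>
    proof (cases "l0 + int k \<le> 0")
      case True
      define d where "d = nat (- l0 - int k)"
      have "W z = residue (\<lambda>t. (t - t0) ^ d * U t * exp (- z * (t - t0))) t0" for z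
        unfolding W_def by (rule residue_cong_punctured_ball[OF r])
          (use True in \<open>simp add: \<phi>U d_def power_int_def\<close>)
      also have "residue (\<lambda>t. (t - t0) ^ d * U t * exp (- z * (t - t0))) t0 = 0" for z
        using r by (intro residue_holo[of "ball t0 r"] holomorphic_intros U) auto
      finally have "W z = poly 0 z" for z
        by simp
      moreover have "l0 < 0" if "Q0 n a t0 \<noteq> 0"
        using k that m True by simp
      ultimately show ?thesis by (intro exI[of _ 0]) auto
    next
      case False
      \<comment> \<open>A pole of order \<open>Suc d\<close> gives a polynomial of degree
        \<open>d\<close>; for \<open>k = 1\<close> this is \<open>l0\<close>.\<close>
      define d where "d = nat (l0 + int k - 1)"
      have d: "l0 + int k = int (Suc d)"
        using False by (simp add: d_def)
      have e: "- l0 - int k = - int (Suc d)"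
        using d by linarith
      have W: "W z = residue (\<lambda>t. U t / (t - t0) ^ Suc d * exp (- z * (t - t0))) t0" for z
        unfolding W_def
      proof (rule residue_cong_punctured_ball[OF r])
        show "\<phi> t * exp (- z * (t - t0)) = U t / (t - t0) ^ Suc d * exp (- z * (t - t0))"
          if "t \<in> ball t0 r - {t0}" for t
          unfolding \<phi>U[OF that] e power_int_minus power_int_of_nat by (simp only: divide_inverse mult_ac)
      qed
      obtain p where "\<forall>z. W z = poly p z" "p \<noteq> 0" "degree p = d"
        using residue_exp_polynomial[OF U r U0, of d] unfolding W by metis
      moreover have "l0 = int d" if "Q0 n a t0 \<noteq> 0"
        using k that m d by simp
      ultimately show ?thesis by auto
    qed
  qed
  ultimately show "\<exists>W. (\<forall>z. w z = exp (- t0 * z) * W z) \<and>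
      (m > 1 \<longrightarrow> transcendental_entire W \<and> growth_order W \<le> ereal (1 - 1 / real m)) \<and>
      (m = 1 \<longrightarrow> (\<exists>p. (\<forall>z. W z = poly p z) \<and>
         (Q0 n a t0 \<noteq> 0 \<longrightarrow> (l0 \<ge> 0 \<longrightarrow> p \<noteq> 0 \<and> int (degree p) = l0) \<and> (l0 < 0 \<longrightarrow> p = 0))))"
    using wW by blast
qed

end
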